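(* Let $M$ be a smooth $n$-manifold and let $g(t)$, $t\in[0,T)$, be a solution of the Ricci flow $\frac{\partial}{\partial t}g_{ij}=-2R_{ij}$ on $M$. Let $h=h(t)$ be a time-dependent symmetric $2$-tensor on $M$ satisfying $$\frac{\partial}{\partial t}h_{ij}=\Delta h_{ij}+2R_{pijq}h_{pq}-R_{iq}h_{jq}-R_{jq}h_{iq}.$$ Then the associated space-time symmetric $2$-tensor $\tilde h$ on $\tilde M=M\times[0,T)$ satisfies, for all $0\le i,j\le n$, $$\tilde\nabla_0\tilde h_{ij}=\tilde\Delta\tilde h_{ij}+2\tilde h_{pq}\tilde R^q_{pij},$$ or equivalently, $$\frac{\partial}{\partial t}\tilde h_{ij}=\tilde\Delta\tilde h_{ij}+2\tilde h_{pq}\tilde R^q_{pij}-\tilde R_{iq}\tilde h_{jq}-\tilde R_{jq}\tilde h_{iq}.$$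
   Context: Local coordinates on $\tilde M=M\times[0,T)$ are $(x^0,x^1,\dots,x^n)$, where $x^1,\dots,x^n$ are local coordinates on $M$ and $x^0=t$. $\nabla$, $\Delta$, $\Gamma_{ij}^k$, $R^l_{ijk}$, $R_{ij}$, $R$ are the Levi-Civita connection, Laplacian, Christoffel symbols, Riemann, Ricci and scalar curvature of $g(t)$. Curvature conventions: $R^l_{ijk}=\partial_i\Gamma^l_{jk}-\partial_j\Gamma^l_{ik}+\Gamma^p_{jk}\Gamma^l_{ip}-\Gamma^p_{ik}\Gamma^l_{jp}$, $R_{ijkl}=g_{lm}R^m_{ijk}$, $R_{jk}=R^p_{pjk}$. The degenerate space-time metric on $T^*\tilde M$ is $\tilde g^{ij}=g^{ij}$ if $i,j\ge1$ and $\tilde g^{ij}=0$ if $i=0$ or $j=0$. The space-time connection $\tilde\nabla$ is the symmetric connection ($\tilde\Gamma_{ij}^k=\tilde\Gamma_{ji}^k$) with $\tilde\Gamma_{ij}^k=\Gamma_{ij}^k$ if $i,j,k\ge1$; $\tilde\Gamma_{ij}^0=0$ if $i,j\ge0$; $\tilde\Gamma_{i0}^k=-R_i^k$ if $i,k\ge1$; $\tilde\Gamma_{00}^k=-\frac12\nabla^kR$ if $k\ge1$. Its Riemann and Ricci curvatures are $\tilde R^l_{ijk}=\partial_i\tilde\Gamma^l_{jk}-\partial_j\tilde\Gamma^l_{ik}+\tilde\Gamma^p_{jk}\tilde\Gamma^l_{ip}-\tilde\Gamma^p_{ik}\tilde\Gamma^l_{jp}$ and $\tilde R_{jk}=\tilde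 R^p_{pjk}$ (indices from $0$ to $n$), and $\tilde\Delta=\tilde g^{ij}\tilde\nabla_i\tilde\nabla_j$. The space-time extension $\tilde h$ of $h$ is the symmetric $2$-tensor on $\tilde M$ with $\tilde h_{ij}=h_{ij}$ if $i,j\ge1$; $\tilde h_{0j}=\tilde h_{j0}=\mathrm{div}(h)_j$ if $j\ge1$; $\tilde h_{00}=\mathrm{div}(\mathrm{div}(h))+Rc\cdot h$. Here $\mathrm{div}(h)_j=g^{pq}\nabla_ph_{qj}$, $\mathrm{div}(\mathrm{div}(h))=g^{jk}\nabla_j\mathrm{div}(h)_k$ and $Rc\cdot h=g^{ip}g^{jq}R_{ij}h_{pq}$. Repeated lower indices are contracted with $g^{-1}$ (for space tensors) or $\tilde g$ (for space-time tensors); e.g. $\tilde h_{pq}\tilde R^q_{pij}=\tilde g^{pr}\tilde h_{rq}\tilde R^q_{pij}$ and $\tilde R_{iq}\tilde h_{jq}=\tilde g^{qr}\tilde R_{iq}\tilde h_{jr}$. $\frac{\partial}{\partial t}\tilde h_{ij}$ is the time derivative of the components in these coordinates. *)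

theory Defs
  imports "HOL-Analysis.Analysis"
begin

section \<open>Partial derivatives and smooth functions\<close>

text \<open>
  Partial derivatives are taken within \<open>S\<close>, so that on \<open>\<Omega> \<times> [0,T)\<close> the time derivative at
  \<open>t = 0\<close> is one-sided; in the directions in which \<open>S\<close> is open this is the usual derivative.
\<close>

definition line_in :: "(real^'m) set \<Rightarrow> 'm \<Rightarrow> real^'m \<Rightarrow> real set" where
  "line_in S i x = {s. x + s *\<^sub>R axis i 1 \<in> S}"

definition has_pd :: "(real^'m) set \<Rightarrow> 'm \<Rightarrow> (real^'m \<Rightarrow> real) \<Rightarrow> real^'m \<Rightarrow> bool" where
  "has_pd S i f x \<longleftrightarrow> (\<lambda>s. f (x + s *\<^sub>R axis i 1)) differentiable (at 0 within line_in S i x)"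

definition pd :: "(real^'m) set \<Rightarrow> 'm \<Rightarrow> (real^'m \<Rightarrow> real) \<Rightarrow> real^'m \<Rightarrow> real" where
  "pd S i f x = vector_derivative (\<lambda>s. f (x + s *\<^sub>R axis i 1)) (at 0 within line_in S i x)"

primrec Ck_on :: "nat \<Rightarrow> (real^'m) set \<Rightarrow> (real^'m \<Rightarrow> real) \<Rightarrow> bool" where
  "Ck_on 0 S f \<longleftrightarrow> continuous_on S f"
| "Ck_on (Suc k) S f \<longleftrightarrow>
     continuous_on S f \<and> (\<forall>i. (\<forall>x\<in>S. has_pd S i f x) \<and> Ck_on k S (pd S i f))"

definition smooth_on :: "(real^'m) set \<Rightarrow> (real^'m \<Rightarrow> real) \<Rightarrow> bool" where
  "smooth_on S f \<longleftrightarrow> (\<forall>k. Ck_on k S f)"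


section \<open>Connections, covariant derivatives and curvature in coordinates\<close>

text \<open>
  Tensor fields on a coordinate domain are given by their components.  A connection is given by
  its coefficients, with \<open>\<Gamma> x i j k\<close> standing for $\Gamma_{ij}^k$ at \<open>x\<close>.  The index
  type \<open>'m\<close> is used both for space and for space-time.
\<close>

type_synonym 'm form1 = "real^'m \<Rightarrow> 'm \<Rightarrow> real"
type_synonym 'm form2 = "real^'m \<Rightarrow> 'm \<Rightarrow> 'm \<Rightarrow> real"
type_synonym 'm form3 = "real^'m \<Rightarrow> 'm \<Rightarrow> 'm \<Rightarrow> 'm \<Rightarrow> real"
type_synonym 'm conn = "real^'m \<Rightarrow> 'm \<Rightarrow> 'm \<Rightarrow> 'm \<Rightarrow> real"

text \<open>\<open>cov1 S \<Gamma> w x k j\<close> is $\nabla_k w_j$; in general the first index is that of the derivative.\<close>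

definition cov1 :: "(real^'m::finite) set \<Rightarrow> 'm conn \<Rightarrow> 'm form1 \<Rightarrow> 'm form2" where
  "cov1 S \<Gamma> w x k j = pd S k (\<lambda>y. w y j) x - (\<Sum>p\<in>UNIV. \<Gamma> x k j p * w x p)"

definition cov2 :: "(real^'m::finite) set \<Rightarrow> 'm conn \<Rightarrow> 'm form2 \<Rightarrow> 'm form3" where
  "cov2 S \<Gamma> h x k i j = pd S k (\<lambda>y. h y i j) x
     - (\<Sum>p\<in>UNIV. \<Gamma> x k i p * h x p j) - (\<Sum>p\<in>UNIV. \<Gamma> x k j p * h x i p)"

definition cov3 ::
  "(real^'m::finite) set \<Rightarrow> 'm conn \<Rightarrow> 'm form3 \<Rightarrow> real^'m \<Rightarrow> 'm \<Rightarrow> 'm \<Rightarrow> 'm \<Rightarrow> 'm \<Rightarrow> real" where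
  "cov3 S \<Gamma> B x l k i j = pd S l (\<lambda>y. B y k i j) x
     - (\<Sum>p\<in>UNIV. \<Gamma> x l k p * B x p i j)
     - (\<Sum>p\<in>UNIV. \<Gamma> x l i p * B x k p j)
     - (\<Sum>p\<in>UNIV. \<Gamma> x l j p * B x k i p)"

text \<open>
  The Laplacian $G^{kl}\nabla_k\nabla_l h_{ij}$, for a contravariant (possibly degenerate)
  metric \<open>G\<close>.
\<close>

definition laplace2 ::
  "(real^'m::finite) set \<Rightarrow> 'm form2 \<Rightarrow> 'm conn \<Rightarrow> 'm form2 \<Rightarrow> 'm form2" where
  "laplace2 S G \<Gamma> h x i j =
     (\<Sum>k\<in>UNIV. \<Sum>l\<in>UNIV. G x k l * cov3 S \<Gamma> (cov2 S \<Gamma> h) x k l i j)"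

text \<open>\<open>riem S \<Gamma> x l i j k\<close> is $R^l_{ijk}$: the upper index comes first.\<close>

definition riem ::
  "(real^'m::finite) set \<Rightarrow> 'm conn \<Rightarrow> real^'m \<Rightarrow> 'm \<Rightarrow> 'm \<Rightarrow> 'm \<Rightarrow> 'm \<Rightarrow> real" where
  "riem S \<Gamma> x l i j k =
     pd S i (\<lambda>y. \<Gamma> y j k l) x - pd S j (\<lambda>y. \<Gamma> y i k l) x
     + (\<Sum>p\<in>UNIV. \<Gamma> x j k p * \<Gamma> x i p l) - (\<Sum>p\<in>UNIV. \<Gamma> x i k p * \<Gamma> x j p l)"

definition ric :: "(real^'m::finite) set \<Rightarrow> 'm conn \<Rightarrow> 'm form2" where
  "ric S \<Gamma> x j k = (\<Sum>p\<in>UNIV. riem S \<Gamma> x p p j k)"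


section \<open>Geometry of a Riemannian metric in coordinates\<close>

definition metric_inv :: "'n::finite form2 \<Rightarrow> 'n form2" where
  "metric_inv g x i j = matrix_inv (\<chi> a b. g x a b) $ i $ j"

definition levi_civita :: "(real^'n::finite) set \<Rightarrow> 'n form2 \<Rightarrow> 'n conn" where
  "levi_civita S g x i j k =
     1/2 * (\<Sum>l\<in>UNIV. metric_inv g x k l *
       (pd S i (\<lambda>y. g y j l) x + pd S j (\<lambda>y. g y i l) x - pd S l (\<lambda>y. g y i j) x))"

definition Rm :: "(real^'n::finite) set \<Rightarrow> 'n form2 \<Rightarrow> real^'n \<Rightarrow> 'n \<Rightarrow> 'n \<Rightarrow> 'n \<Rightarrow> 'n \<Rightarrow> real" where
  "Rm S g x i j k l = (\<Sum>m\<in>UNIV. g x l m * riem S (levi_civita S g) x m i j k)"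

definition Rc :: "(real^'n::finite) set \<Rightarrow> 'n form2 \<Rightarrow> 'n form2" where
  "Rc S g = ric S (levi_civita S g)"

definition scal :: "(real^'n::finite) set \<Rightarrow> 'n form2 \<Rightarrow> real^'n \<Rightarrow> real" where
  "scal S g x = (\<Sum>j\<in>UNIV. \<Sum>k\<in>UNIV. metric_inv g x j k * Rc S g x j k)"

text \<open>$R_i^k$ and $\nabla^k R$.\<close>

definition Rc_up :: "(real^'n::finite) set \<Rightarrow> 'n form2 \<Rightarrow> 'n form2" where
  "Rc_up S g x i k = (\<Sum>l\<in>UNIV. metric_inv g x k l * Rc S g x i l)"

definition grad_scal :: "(real^'n::finite) set \<Rightarrow> 'n form2 \<Rightarrow> 'n form1" where
  "grad_scal S g x k = (\<Sum>l\<in>UNIV. metric_inv g x k l * pd S l (scal S g) x)"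

definition div2 :: "(real^'n::finite) set \<Rightarrow> 'n form2 \<Rightarrow> 'n form2 \<Rightarrow> 'n form1" where
  "div2 S g h x j =
     (\<Sum>p\<in>UNIV. \<Sum>q\<in>UNIV. metric_inv g x p q * cov2 S (levi_civita S g) h x p q j)"

definition divdiv :: "(real^'n::finite) set \<Rightarrow> 'n form2 \<Rightarrow> 'n form2 \<Rightarrow> real^'n \<Rightarrow> real" where
  "divdiv S g h x =
     (\<Sum>j\<in>UNIV. \<Sum>k\<in>UNIV. metric_inv g x j k * cov1 S (levi_civita S g) (div2 S g h) x j k)"

definition Rc_dot :: "(real^'n::finite) set \<Rightarrow> 'n form2 \<Rightarrow> 'n form2 \<Rightarrow> real^'n \<Rightarrow> real" where
  "Rc_dot S g h x =
     (\<Sum>i\<in>UNIV. \<Sum>j\<in>UNIV. \<Sum>p\<in>UNIV. \<Sum>q\<in>UNIV.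
        metric_inv g x i p * metric_inv g x j q * Rc S g x i j * h x p q)"

text \<open>
  The right-hand side $\Delta h_{ij} + 2R_{pijq}h_{pq} - R_{iq}h_{jq} - R_{jq}h_{iq}$ of the
  evolution equation of \<open>h\<close>; repeated lower indices are contracted with the inverse metric.
\<close>

definition evol_rhs :: "(real^'n::finite) set \<Rightarrow> 'n form2 \<Rightarrow> 'n form2 \<Rightarrow> 'n form2" where
  "evol_rhs S g h x i j =
     laplace2 S (metric_inv g) (levi_civita S g) h x i j
     + 2 * (\<Sum>p\<in>UNIV. \<Sum>q\<in>UNIV. \<Sum>r\<in>UNIV. \<Sum>s\<in>UNIV.
              metric_inv g x p r * metric_inv g x q s * Rm S g x p i j q * h x r s)
     - (\<Sum>q\<in>UNIV. \<Sum>r\<in>UNIV. metric_inv g x q r * Rc S g x i q * h x j r)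
     - (\<Sum>q\<in>UNIV. \<Sum>r\<in>UNIV. metric_inv g x q r * Rc S g x j q * h x i r)"


section \<open>Space-time\<close>

text \<open>
  Space-time coordinates $(x^0,\dots,x^n)$ are indexed by \<open>'n option\<close>: \<open>None\<close> is the time
  index $0$ and \<open>Some i\<close> are the space indices.  In this section \<open>g\<close> and \<open>h\<close> depend on time,
  and \<open>\<Omega>\<close> is the space coordinate domain.
\<close>

definition time_interval :: "ereal \<Rightarrow> real set" where
  "time_interval T = {t. 0 \<le> t \<and> ereal t < T}"

definition space_part :: "real^('n option) \<Rightarrow> real^'n" where
  "space_part z = (\<chi> i. z $ Some i)"

definition event :: "real \<Rightarrow> real^'n \<Rightarrow> real^('n option)" where
  "event t x = (\<chi> a. case a of None \<Rightarrow> t | Some i \<Rightarrow> x $ i)"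

definition st_dom :: "real set \<Rightarrow> (real^'n) set \<Rightarrow> (real^('n option)) set" where
  "st_dom I \<Omega> = {z. z $ None \<in> I \<and> space_part z \<in> \<Omega>}"

fun st_cometric :: "(real \<Rightarrow> 'n::finite form2) \<Rightarrow> 'n option form2" where
  "st_cometric g z (Some i) (Some j) = metric_inv (g (z $ None)) (space_part z) i j"
| "st_cometric g z None b = 0"
| "st_cometric g z (Some i) None = 0"

fun st_conn :: "(real^'n::finite) set \<Rightarrow> (real \<Rightarrow> 'n form2) \<Rightarrow> 'n option conn" where
  "st_conn \<Omega> g z (Some i) (Some j) (Some k) = levi_civita \<Omega> (g (z $ None)) (space_part z) i j k"
| "st_conn \<Omega> g z (Some i) None (Some k) = - Rc_up \<Omega> (g (z $ None)) (space_part z) i k"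
| "st_conn \<Omega> g z None (Some i) (Some k) = - Rc_up \<Omega> (g (z $ None)) (space_part z) i k"
| "st_conn \<Omega> g z None None (Some k) = - (1/2) * grad_scal \<Omega> (g (z $ None)) (space_part z) k"
| "st_conn \<Omega> g z a b None = 0"

fun st_ext ::
  "(real^'n::finite) set \<Rightarrow> (real \<Rightarrow> 'n form2) \<Rightarrow> (real \<Rightarrow> 'n form2) \<Rightarrow> 'n option form2" where
  "st_ext \<Omega> g h z (Some i) (Some j) = h (z $ None) (space_part z) i j"
| "st_ext \<Omega> g h z None (Some j) = div2 \<Omega> (g (z $ None)) (h (z $ None)) (space_part z) j"
| "st_ext \<Omega> g h z (Some j) None = div2 \<Omega> (g (z $ None)) (h (z $ None)) (space_part z) j"
| "st_ext \<Omega> g h z None None =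
     divdiv \<Omega> (g (z $ None)) (h (z $ None)) (space_part z)
     + Rc_dot \<Omega> (g (z $ None)) (h (z $ None)) (space_part z)"

text \<open>
  The terms $\tilde h_{pq}\tilde R^q_{pij}$ and $\tilde R_{iq}\tilde h_{jq}$, for a
  contravariant metric \<open>G\<close>, a connection \<open>\<Gamma>\<close> and a 2-tensor \<open>H\<close>.  In the first one only
  the lower pair \<open>p\<close> needs the metric.
\<close>

definition riem_term ::
  "(real^'m::finite) set \<Rightarrow> 'm form2 \<Rightarrow> 'm conn \<Rightarrow> 'm form2 \<Rightarrow> 'm form2" where
  "riem_term S G \<Gamma> H z i j =
     (\<Sum>p\<in>UNIV. \<Sum>q\<in>UNIV. \<Sum>r\<in>UNIV. G z p r * H z r q * riem S \<Gamma> z q p i j)"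

definition ric_term ::
  "(real^'m::finite) set \<Rightarrow> 'm form2 \<Rightarrow> 'm conn \<Rightarrow> 'm form2 \<Rightarrow> 'm form2" where
  "ric_term S G \<Gamma> H z i j = (\<Sum>q\<in>UNIV. \<Sum>r\<in>UNIV. G z q r * ric S \<Gamma> z i q * H z j r)"


section \<open>Manifolds, tensor fields and the Ricci flow\<close>

text \<open>
  A chart is a pair of a domain in \<open>M\<close> and a coordinate map, of which only the values on
  the domain matter.  A smooth structure is given by an atlas, which may or may not be maximal.
\<close>

type_synonym ('a, 'n) chart = "'a set \<times> ('a \<Rightarrow> real^'n)"

definition coord_dom :: "('a, 'n) chart \<Rightarrow> (real^'n) set" where
  "coord_dom c = snd c ` fst c"

definition overlap_dom :: "('a, 'n) chart \<Rightarrow> ('a, 'n) chart \<Rightarrow> (real^'n) set" where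
  "overlap_dom c d = snd c ` (fst c \<inter> fst d)"

definition transition :: "('a, 'n) chart \<Rightarrow> ('a, 'n) chart \<Rightarrow> real^'n \<Rightarrow> real^'n" where
  "transition c d x = snd d (inv_into (fst c) (snd c) x)"

definition is_chart :: "'a topology \<Rightarrow> ('a, 'n::finite) chart \<Rightarrow> bool" where
  "is_chart M c \<longleftrightarrow> openin M (fst c) \<and> open (coord_dom c) \<and>
     homeomorphic_map (subtopology M (fst c)) (top_of_set (coord_dom c)) (snd c)"

definition smooth_manifold :: "'a topology \<Rightarrow> ('a, 'n::finite) chart set \<Rightarrow> bool" where
  "smooth_manifold M A \<longleftrightarrow>
     Hausdorff_space M \<and> second_countable M \<and>
     (\<forall>c\<in>A. is_chart M c) \<and> (\<Union>c\<in>A. fst c) = topspace M \<and>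
     (\<forall>c\<in>A. \<forall>d\<in>A. \<forall>k. smooth_on (overlap_dom c d) (\<lambda>x. transition c d x $ k))"

text \<open>
  A covariant 2-tensor field is a family of components, one matrix of functions of the
  coordinates for each chart of the atlas, obeying the tensor transformation law.
\<close>

type_synonym ('a, 'n) tensor2 = "('a, 'n) chart \<Rightarrow> 'n form2"

definition tensor2_field :: "('a, 'n::finite) chart set \<Rightarrow> ('a, 'n) tensor2 \<Rightarrow> bool" where
  "tensor2_field A B \<longleftrightarrow>
     (\<forall>c\<in>A. \<forall>d\<in>A. \<forall>x\<in>overlap_dom c d. \<forall>i j.
        B c x i j =
          (\<Sum>k\<in>UNIV. \<Sum>l\<in>UNIV.
             pd (overlap_dom c d) i (\<lambda>y. transition c d y $ k) x *
             pd (overlap_dom c d) j (\<lambda>y. transition c d y $ l) x *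
             B d (transition c d x) k l))"

definition time_dep_sym_tensor ::
  "('a, 'n::finite) chart set \<Rightarrow> real set \<Rightarrow> (real \<Rightarrow> ('a, 'n) tensor2) \<Rightarrow> bool" where
  "time_dep_sym_tensor A I B \<longleftrightarrow>
     (\<forall>t\<in>I. tensor2_field A (B t)) \<and>
     (\<forall>t\<in>I. \<forall>c\<in>A. \<forall>x\<in>coord_dom c. \<forall>i j. B t c x i j = B t c x j i) \<and>
     (\<forall>c\<in>A. \<forall>i j. smooth_on (st_dom I (coord_dom c)) (\<lambda>z. B (z $ None) c (space_part z) i j))"

definition time_dep_metric ::
  "('a, 'n::finite) chart set \<Rightarrow> real set \<Rightarrow> (real \<Rightarrow> ('a, 'n) tensor2) \<Rightarrow> bool" where
  "time_dep_metric A I g \<longleftrightarrow> time_dep_sym_tensor A I g \<and>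
     (\<forall>t\<in>I. \<forall>c\<in>A. \<forall>x\<in>coord_dom c. \<forall>v::real^'n. v \<noteq> 0 \<longrightarrow>
        (\<Sum>i\<in>UNIV. \<Sum>j\<in>UNIV. g t c x i j * v $ i * v $ j) > 0)"

definition ricci_flow ::
  "('a, 'n::finite) chart set \<Rightarrow> real set \<Rightarrow> (real \<Rightarrow> ('a, 'n) tensor2) \<Rightarrow> bool" where
  "ricci_flow A I g \<longleftrightarrow> time_dep_metric A I g \<and>
     (\<forall>t\<in>I. \<forall>c\<in>A. \<forall>x\<in>coord_dom c. \<forall>i j.
        ((\<lambda>s. g s c x i j) has_real_derivative - 2 * Rc (coord_dom c) (g t c) x i j)
          (at t within I))"

end

theory Submission
  imports Defs
begin

text \<open>
  With respect to the degenerate cometric $\tilde g^{-1}$, which is parallel for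
  $\tilde\nabla$, space-time behaves like a steady soliton: the vector field
  $\partial_0$ satisfies $\tilde\nabla_a (\partial_0)^k = -\tilde g^{kl}\tilde R_{al}$ for
  all $a$, including $a = 0$ by the contracted second Bianchi identity.  The definition of
  $\tilde h$ says that $\tilde h_{0j} = \tilde g^{pq}\tilde\nabla_p\tilde h_{qj}$ for all $j$,
  including $j = 0$.  Commuting derivatives, one finds that
  $K_{ij} = \tilde\nabla_0\tilde h_{ij} - \tilde\Delta\tilde h_{ij}
    - 2\tilde h_{pq}\tilde R^q_{pij}$
  satisfies the same relation $K_{0j} = \tilde g^{pq}\tilde\nabla_p K_{qj}$.  The evolution
  equation of $h$ is $K_{ij} = 0$ for $i,j \ge 1$; hence $K_{0j} = 0$ for $j \ge 1$, and then
  $K_{00} = 0$.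
\<close>

section \<open>Partial derivatives within a domain\<close>

text \<open>They are replaced by one identity: since G is parallel, G^km R^l_ijm is antisymmetric in
  k and l. Ricci flow is what makes G parallel in time, because the coefficients \<Gamma>_0p^i =
  -R_p^i compensate the derivative 2R^ij of g^ij. The soliton relation at a = 0 amounts to R_0l =
  1/2 \<partial>_l R, which is derived from the relation for the other indices alone; otherwise the
  argument would be circular. The passage from space components of K to K_0j rests on \<Gamma>_ab^0
  = 0: the space derivatives of K_qj with q and j in space do not see the time components of K. At t
  = 0 derivatives are one-sided, and exchanging them there is a limit of exchanging them at t >
  0.\<close>

lemma zero_in_line_in: "x \<in> S \<Longrightarrow> 0 \<in> line_in S i x"
  by (simp add: line_in_def)

lemma has_pd_iff:
  "has_pd S i f x \<longleftrightarrow>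
    ((\<lambda>s. f (x + s *\<^sub>R axis i 1)) has_vector_derivative pd S i f x) (at 0 within line_in S i x)"
  by (simp add: has_pd_def pd_def vector_derivative_works)

lemma has_pd_cong:
  assumes "x \<in> S" "\<And>y. y \<in> S \<Longrightarrow> f y = g y"
  shows "has_pd S i f x \<longleftrightarrow> has_pd S i g x"
proof -
  have "(\<lambda>s. k (x + s *\<^sub>R axis i 1)) differentiable (at 0 within line_in S i x)"
    if "\<And>y. y \<in> S \<Longrightarrow> k y = l y"
      "(\<lambda>s. l (x + s *\<^sub>R axis i 1)) differentiable (at 0 within line_in S i x)" for k l :: "real^'a \<Rightarrow> real"
    using has_vector_derivative_transform[OF zero_in_line_in[OF assms(1)]] that
    by (metis (mono_tags, lifting) line_in_def mem_Collect_eq vector_derivative_works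
        differentiableI_vector)
  then show ?thesis
    unfolding has_pd_def using assms(2) by metis
qed

lemma pd_cong:
  assumes "x \<in> S" "\<And>y. y \<in> S \<Longrightarrow> f y = g y"
  shows "pd S i f x = pd S i g x"
  unfolding pd_def
  using assms zero_in_line_in[OF assms(1)]
  by (intro vector_derivative_cong_eq) (auto simp: line_in_def)

lemma Ck_on_cong:
  assumes "\<And>y. y \<in> S \<Longrightarrow> f y = g y"
  shows "Ck_on k S f \<longleftrightarrow> Ck_on k S g"
  using assms
proof (induction k arbitrary: f g)
  case 0
  then show ?case by (auto cong: continuous_on_cong)
next
  case (Suc k)
  have "Ck_on k S (pd S i f) \<longleftrightarrow> Ck_on k S (pd S i g)" for i
    by (rule Suc.IH) (auto intro: pd_cong Suc.prems)
  moreover have "(\<forall>x\<in>S. has_pd S i f x) \<longleftrightarrow> (\<forall>x\<in>S. has_pd S i g x)" for i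
    using has_pd_cong[of _ S f g] Suc.prems by blast
  moreover have "continuous_on S f \<longleftrightarrow> continuous_on S g"
    using Suc.prems by (auto cong: continuous_on_cong)
  ultimately show ?case by simp
qed

lemma smooth_on_cong:
  "(\<And>y. y \<in> S \<Longrightarrow> f y = g y) \<Longrightarrow> smooth_on S f \<longleftrightarrow> smooth_on S g"
  unfolding smooth_on_def using Ck_on_cong[of S f g] by blast

lemma Ck_on_SucD: "Ck_on (Suc k) S f \<Longrightarrow> Ck_on k S f"
  by (induction k arbitrary: f) auto

lemma Ck_on_continuous: "Ck_on k S f \<Longrightarrow> continuous_on S f"
  by (cases k) auto

lemma smooth_on_continuous: "smooth_on S f \<Longrightarrow> continuous_on S f"
  unfolding smooth_on_def using Ck_on_continuous by blast

lemma smooth_on_has_pd: "smooth_on S f \<Longrightarrow> x \<in> S \<Longrightarrow> has_pd S i f x"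
  unfolding smooth_on_def by (metis Ck_on.simps(2))

lemma smooth_on_pd [simp]: "smooth_on S f \<Longrightarrow> smooth_on S (pd S i f)"
  unfolding smooth_on_def by (metis Ck_on.simps(2))

section \<open>Symmetry of mixed partial derivatives\<close>

lemma has_field_derivative_line:
  assumes "has_pd S i f (x + s *\<^sub>R axis i 1)"
    and "x + s *\<^sub>R axis i 1 \<in> interior S"
  shows "((\<lambda>u. f (x + u *\<^sub>R axis i 1)) has_real_derivative pd S i f (x + s *\<^sub>R axis i 1)) (at s)"
proof -
  let ?y = "x + s *\<^sub>R axis i 1"
  \<comment> \<open>Passing to the interior makes this set of parameters open, so the derivative
    within the line becomes the two-sided one that the mean value theorem asks for.\<close>
  let ?U = "{u. ?y + u *\<^sub>R axis i 1 \<in> interior S}"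
  have U: "open ?U"
    using open_vimage[of "interior S" "\<lambda>u. ?y + u *\<^sub>R axis i 1"]
    by (simp add: vimage_def continuous_intros)
  have "((\<lambda>u. f (?y + u *\<^sub>R axis i 1)) has_vector_derivative pd S i f ?y) (at 0 within ?U)"
    using assms(1) interior_subset[of S] unfolding has_pd_iff
    by (auto elim!: has_vector_derivative_within_subset simp: line_in_def)
  then have "((\<lambda>u. f (?y + u *\<^sub>R axis i 1)) has_vector_derivative pd S i f ?y) (at 0)"
    using assms(2) U by (subst (asm) has_vector_derivative_within_open) auto
  then have "((\<lambda>u. f (x + (u + s) *\<^sub>R axis i 1)) has_real_derivative pd S i f ?y) (at 0)"
    by (simp add: has_real_derivative_iff_has_vector_derivative algebra_simps)
  then show ?thesis
    using DERIV_shift[of "\<lambda>u. f (x + u *\<^sub>R axis i 1)" _ 0 s] by simp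
qed

text \<open>The second difference over the square of side \<open>e\<close> at \<open>x\<close>, divided by \<open>e\<^sup>2\<close>, is a value of the
  mixed partial derivative, in whichever order the mean value theorem is applied.\<close>

lemma second_difference_mixed:
  fixes x :: "real^'m::finite"
  assumes box: "\<And>s t. 0 \<le> s \<Longrightarrow> s \<le> e \<Longrightarrow> 0 \<le> t \<Longrightarrow> t \<le> e \<Longrightarrow>
      x + s *\<^sub>R axis i 1 + t *\<^sub>R axis j 1 \<in> interior S"
    and e: "0 < e" and f: "Ck_on 2 S f"
  shows "\<exists>s t. 0 < s \<and> s < e \<and> 0 < t \<and> t < e \<and>
    f (x + e *\<^sub>R axis i 1 + e *\<^sub>R axis j 1) - f (x + e *\<^sub>R axis i 1)
      - f (x + e *\<^sub>R axis j 1) + f x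
    = e * e * pd S j (pd S i f) (x + s *\<^sub>R axis i 1 + t *\<^sub>R axis j 1)"
proof -
  have S: "\<And>y. y \<in> interior S \<Longrightarrow> y \<in> S" using interior_subset by auto
  have f1: "has_pd S i f y" and f2: "has_pd S j (pd S i f) y" if "y \<in> interior S" for y
    using f S[OF that] by (auto simp: numeral_2_eq_2)
  let ?F = "\<lambda>s. f (x + e *\<^sub>R axis j 1 + s *\<^sub>R axis i 1) - f (x + s *\<^sub>R axis i 1)"
  let ?F' = "\<lambda>s. pd S i f (x + e *\<^sub>R axis j 1 + s *\<^sub>R axis i 1) - pd S i f (x + s *\<^sub>R axis i 1)"
  have "(?F has_real_derivative ?F' s) (at s)" if "0 \<le> s" "s \<le> e" for s
    using box[OF that, of 0] box[OF that, of e] e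
    by (intro DERIV_diff has_field_derivative_line f1) (auto simp: algebra_simps)
  then obtain s where s: "0 < s" "s < e" "?F e - ?F 0 = e * ?F' s"
    using MVT2[of 0 e ?F ?F'] e by auto
  let ?y = "x + s *\<^sub>R axis i 1"
  let ?H = "\<lambda>t. pd S i f (?y + t *\<^sub>R axis j 1)"
  have "(?H has_real_derivative pd S j (pd S i f) (?y + t *\<^sub>R axis j 1)) (at t)"
    if "0 \<le> t" "t \<le> e" for t
    using box[of s t] that s by (intro has_field_derivative_line f2) auto
  then obtain t where t: "0 < t" "t < e"
      "?H e - ?H 0 = e * pd S j (pd S i f) (?y + t *\<^sub>R axis j 1)"
    using MVT2[of 0 e ?H "\<lambda>t. pd S j (pd S i f) (?y + t *\<^sub>R axis j 1)"] e by auto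
  have "?F e - ?F 0 = e * (?H e - ?H 0)"
    using s(3) by (simp add: algebra_simps)
  then show ?thesis
    using s t by (intro exI[of _ s] exI[of _ t]) (simp add: algebra_simps)
qed

text \<open>The second difference is the same in both orders, so the two mixed partials share a
  value at some points of each small square at \<open>x\<close>. Were they to differ at
  \<open>x\<close> by \<open>2 * d\<close>, continuity would keep each within \<open>d\<close> of
  its value at \<open>x\<close>, and no value could be shared.\<close>

lemma pd_commute_interior:
  fixes x :: "real^'m::finite"
  assumes x: "x \<in> interior S" and f: "Ck_on 2 S f"
  shows "pd S j (pd S i f) x = pd S i (pd S j f) x"
proof (rule ccontr)
  let ?P = "\<lambda>i j. pd S j (pd S i f)"
  assume neq: "\<not> ?thesis"
  define d where "d = \<bar>?P i j x - ?P j i x\<bar> / 2"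
  have d: "d > 0" using neq by (simp add: d_def)
  have c: "continuous_on (interior S) (?P i j)" for i j
    using f by (auto simp: numeral_2_eq_2 intro: continuous_on_subset[OF _ interior_subset])
  have "\<exists>r>0. ball x r \<subseteq> interior S \<and> (\<forall>y\<in>ball x r. \<bar>?P i j y - ?P i j x\<bar> < d)" for i j
  proof -
    obtain r1 where r1: "r1 > 0" "ball x r1 \<subseteq> interior S"
      using x open_interior open_contains_ball by blast
    obtain r2 where r2: "r2 > 0" "\<And>y. y \<in> interior S \<Longrightarrow> dist y x < r2 \<Longrightarrow> dist (?P i j y) (?P i j x) < d"
      using c[of j i] x d unfolding continuous_on_iff by metis
    show ?thesis
      using r1 r2 by (intro exI[of _ "min r1 r2"]) (auto simp: dist_real_def dist_commute subset_iff)
  qed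
  then obtain r1 r2 where r1: "r1 > 0" "ball x r1 \<subseteq> interior S" "\<And>y. y \<in> ball x r1 \<Longrightarrow> \<bar>?P i j y - ?P i j x\<bar> < d"
    and r2: "r2 > 0" "\<And>y. y \<in> ball x r2 \<Longrightarrow> \<bar>?P j i y - ?P j i x\<bar> < d"
    by metis
  define r where "r = min r1 r2"
  have r: "r > 0" "ball x r \<subseteq> interior S"
    and rij: "\<And>y. y \<in> ball x r \<Longrightarrow> \<bar>?P i j y - ?P i j x\<bar> < d"
    and rji: "\<And>y. y \<in> ball x r \<Longrightarrow> \<bar>?P j i y - ?P j i x\<bar> < d"
    using r1 r2 by (auto simp: r_def)
  \<comment> \<open>Points of the square of side \<open>e\<close> are at distance at most
    \<open>2 * e\<close> from \<open>x\<close>; a third of the radius keeps the square inside the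
    ball.\<close>
  define e where "e = r / 3"
  have e: "0 < e" using r by (simp add: e_def)
  have box: "x + s *\<^sub>R axis k 1 + t *\<^sub>R axis l 1 \<in> ball x r"
    if "0 \<le> s" "s \<le> e" "0 \<le> t" "t \<le> e" for s t k l
  proof -
    have "dist x (x + s *\<^sub>R axis k 1 + t *\<^sub>R axis l 1) \<le> norm (s *\<^sub>R (axis k 1 :: real^'m)) + norm (t *\<^sub>R (axis l 1 :: real^'m))"
      by (simp only: dist_norm norm_minus_commute[of x] add.assoc add_diff_cancel_left' norm_triangle_ineq)
    also have "\<dots> \<le> e + e" using that by (simp add: norm_axis_1)
    also have "\<dots> < r" using r by (simp add: e_def)
    finally show ?thesis by simp
  qed
  note sd = second_difference_mixed[OF subsetD[OF r(2) box] e f]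
  obtain s t where st: "0 < s" "s < e" "0 < t" "t < e"
    "f (x + e *\<^sub>R axis i 1 + e *\<^sub>R axis j 1) - f (x + e *\<^sub>R axis i 1) - f (x + e *\<^sub>R axis j 1) + f x
      = e * e * ?P i j (x + s *\<^sub>R axis i 1 + t *\<^sub>R axis j 1)"
    using sd[of i j] by blast
  obtain s' t' where st': "0 < s'" "s' < e" "0 < t'" "t' < e"
    "f (x + e *\<^sub>R axis j 1 + e *\<^sub>R axis i 1) - f (x + e *\<^sub>R axis j 1) - f (x + e *\<^sub>R axis i 1) + f x
      = e * e * ?P j i (x + s' *\<^sub>R axis j 1 + t' *\<^sub>R axis i 1)"
    using sd[of j i] by blast
  have "e * e * ?P i j (x + s *\<^sub>R axis i 1 + t *\<^sub>R axis j 1)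
      = e * e * ?P j i (x + s' *\<^sub>R axis j 1 + t' *\<^sub>R axis i 1)"
    using st(5) st'(5) by (simp add: algebra_simps)
  then have "?P i j (x + s *\<^sub>R axis i 1 + t *\<^sub>R axis j 1)
      = ?P j i (x + s' *\<^sub>R axis j 1 + t' *\<^sub>R axis i 1)"
    using e by simp
  moreover have "\<bar>?P i j (x + s *\<^sub>R axis i 1 + t *\<^sub>R axis j 1) - ?P i j x\<bar> < d"
    using box[of s t i j] rij st by simp
  moreover have "\<bar>?P j i (x + s' *\<^sub>R axis j 1 + t' *\<^sub>R axis i 1) - ?P j i x\<bar> < d"
    using box[of s' t' j i] rji st' by simp
  ultimately have "\<bar>?P i j x - ?P j i x\<bar> < 2 * d" by linarith
  then show False by (simp add: d_def)
qed

text \<open>The two properties of \<Omega> \<times> [0,T) on which the calculus rests: one-sided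
  partial derivatives are unique at every point, and continuous identities extend from the interior
  to the boundary t = 0.\<close>

locale pd_domain =
  fixes S :: "(real^'m::finite) set"
  assumes line_nontrivial: "x \<in> S \<Longrightarrow> at 0 within line_in S i x \<noteq> bot"
    and subset_closure_interior: "S \<subseteq> closure (interior S)"
begin

lemma pd_eqI:
  assumes "x \<in> S"
    and "((\<lambda>s. f (x + s *\<^sub>R axis i 1)) has_vector_derivative d) (at 0 within line_in S i x)"
  shows "has_pd S i f x" "pd S i f x = d"
  using assms vector_derivative_within[OF line_nontrivial]
  by (auto simp: has_pd_def pd_def intro: differentiableI_vector)

lemma
  assumes "x \<in> S"
  shows has_pd_const: "has_pd S i (\<lambda>y. c) x" and pd_const: "pd S i (\<lambda>y. c) x = 0"
  by (rule pd_eqI[OF assms] has_vector_derivative_const)+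

lemma
  assumes "x \<in> S" "has_pd S i f x" "has_pd S i g x"
  shows has_pd_add: "has_pd S i (\<lambda>y. f y + g y) x"
    and pd_add: "pd S i (\<lambda>y. f y + g y) x = pd S i f x + pd S i g x"
  by (rule pd_eqI[OF assms(1)] has_vector_derivative_add assms(2,3)[unfolded has_pd_iff])+

lemma
  assumes "x \<in> S" "has_pd S i f x" "has_pd S i g x"
  shows has_pd_mult: "has_pd S i (\<lambda>y. f y * g y) x"
    and pd_mult: "pd S i (\<lambda>y. f y * g y) x = pd S i f x * g x + f x * pd S i g x"
  using has_vector_derivative_mult[OF assms(2,3)[unfolded has_pd_iff]]
    pd_eqI[OF assms(1)]
  by (simp_all add: add.commute)

text \<open>The derivative is written as a product with the constant -1 and without powers or
  quotients, so that closure of C^k under products and constants applies to it in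
  \<open>Ck_on_inverse\<close>.\<close>

lemma
  assumes "x \<in> S" "has_pd S i f x" "f x \<noteq> 0"
  shows has_pd_inverse: "has_pd S i (\<lambda>y. inverse (f y)) x"
    and pd_inverse: "pd S i (\<lambda>y. inverse (f y)) x = - 1 * (pd S i f x * (inverse (f x) * inverse (f x)))"
proof -
  have "((\<lambda>s. inverse (f (x + s *\<^sub>R axis i 1))) has_vector_derivative
      - 1 * (pd S i f x * (inverse (f x) * inverse (f x)))) (at 0 within line_in S i x)"
    using DERIV_inverse_fun[of "\<lambda>s. f (x + s *\<^sub>R axis i 1)" "pd S i f x" 0 "line_in S i x"]
      assms(2,3)
    by (simp add: has_pd_iff has_real_derivative_iff_has_vector_derivative power2_eq_square numeral_2_eq_2)
  then show "has_pd S i (\<lambda>y. inverse (f y)) x"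
    "pd S i (\<lambda>y. inverse (f y)) x = - 1 * (pd S i f x * (inverse (f x) * inverse (f x)))"
    by (auto intro: pd_eqI[OF assms(1)])
qed

section \<open>Arithmetic of C^k and smooth functions\<close>

lemma Ck_on_const: "Ck_on k S (\<lambda>y. c)"
proof (induction k arbitrary: c)
  case (Suc k)
  have "Ck_on k S (pd S i (\<lambda>y. c))" for i
    using Ck_on_cong[of S "pd S i (\<lambda>y. c)" "\<lambda>y. 0"] Suc.IH[of 0] pd_const by auto
  then show ?case by (simp add: has_pd_const)
qed simp

lemma Ck_on_add: "Ck_on k S f \<Longrightarrow> Ck_on k S g \<Longrightarrow> Ck_on k S (\<lambda>y. f y + g y)"
proof (induction k arbitrary: f g)
  case (Suc k)
  have "Ck_on k S (pd S i (\<lambda>y. f y + g y))" for i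
    using Ck_on_cong[of S "pd S i (\<lambda>y. f y + g y)" "\<lambda>y. pd S i f y + pd S i g y"] Suc pd_add
    by auto
  then show ?case using Suc.prems by (auto intro: has_pd_add continuous_intros)
qed (auto intro: continuous_intros)

lemma Ck_on_mult: "Ck_on k S f \<Longrightarrow> Ck_on k S g \<Longrightarrow> Ck_on k S (\<lambda>y. f y * g y)"
proof (induction k arbitrary: f g)
  case (Suc k)
  have "Ck_on k S (\<lambda>y. pd S i f y * g y + f y * pd S i g y)" for i
    using Suc.prems Ck_on_SucD[OF Suc.prems(1)] Ck_on_SucD[OF Suc.prems(2)]
    by (intro Ck_on_add Suc.IH) simp_all
  then have "Ck_on k S (pd S i (\<lambda>y. f y * g y))" for i
    using Ck_on_cong[of S "pd S i (\<lambda>y. f y * g y)" "\<lambda>y. pd S i f y * g y + f y * pd S i g y"]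
      Suc.prems pd_mult by auto
  then show ?case using Suc.prems by (auto intro: has_pd_mult continuous_intros)
qed (auto intro: continuous_intros)

lemma Ck_on_inverse:
  "Ck_on k S f \<Longrightarrow> (\<And>x. x \<in> S \<Longrightarrow> f x \<noteq> 0) \<Longrightarrow> Ck_on k S (\<lambda>y. inverse (f y))"
proof (induction k)
  case (Suc k)
  have inv: "Ck_on k S (\<lambda>y. inverse (f y))"
    using Suc Ck_on_SucD by blast
  have "Ck_on k S (\<lambda>y. - 1 * (pd S i f y * (inverse (f y) * inverse (f y))))" for i
    using Suc.prems by (intro Ck_on_mult Ck_on_const inv) auto
  then have "Ck_on k S (pd S i (\<lambda>y. inverse (f y)))" for i
    using Ck_on_cong[of S "pd S i (\<lambda>y. inverse (f y))"
        "\<lambda>y. - 1 * (pd S i f y * (inverse (f y) * inverse (f y)))"] Suc.prems pd_inverse by auto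
  then show ?case using Suc.prems by (auto intro: has_pd_inverse continuous_intros)
qed (auto intro: continuous_intros)

lemma smooth_on_const [simp]: "smooth_on S (\<lambda>y. c)"
  by (simp add: smooth_on_def Ck_on_const)

lemma smooth_on_add [simp]: "smooth_on S f \<Longrightarrow> smooth_on S g \<Longrightarrow> smooth_on S (\<lambda>y. f y + g y)"
  by (simp add: smooth_on_def Ck_on_add)

lemma smooth_on_mult [simp]: "smooth_on S f \<Longrightarrow> smooth_on S g \<Longrightarrow> smooth_on S (\<lambda>y. f y * g y)"
  by (simp add: smooth_on_def Ck_on_mult)

lemma smooth_on_divide_const [simp]: "smooth_on S f \<Longrightarrow> smooth_on S (\<lambda>y. f y / c)"
  using smooth_on_mult[of f "\<lambda>y. inverse c"] by (simp add: divide_inverse)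

lemma smooth_on_inverse:
  "smooth_on S f \<Longrightarrow> (\<And>x. x \<in> S \<Longrightarrow> f x \<noteq> 0) \<Longrightarrow> smooth_on S (\<lambda>y. inverse (f y))"
  by (simp add: smooth_on_def Ck_on_inverse)

lemma smooth_on_minus [simp]: "smooth_on S f \<Longrightarrow> smooth_on S (\<lambda>y. - f y)"
  using smooth_on_mult[of "\<lambda>y. - 1" f] by simp

lemma smooth_on_diff [simp]: "smooth_on S f \<Longrightarrow> smooth_on S g \<Longrightarrow> smooth_on S (\<lambda>y. f y - g y)"
  using smooth_on_add[of f "\<lambda>y. - g y"] by simp

lemma smooth_on_sum [simp]: "(\<And>a. smooth_on S (\<lambda>y. f y a)) \<Longrightarrow> smooth_on S (\<lambda>y. \<Sum>a\<in>B. f y a)"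
  by (induction B rule: infinite_finite_induct) auto

lemma smooth_on_prod: "(\<And>a. smooth_on S (\<lambda>y. f y a)) \<Longrightarrow> smooth_on S (\<lambda>y. \<Prod>a\<in>B. f y a)"
  by (induction B rule: infinite_finite_induct) auto

context
  fixes x assumes x: "x \<in> S"
begin

lemma pd_smooth_add:
  "smooth_on S f \<Longrightarrow> smooth_on S g \<Longrightarrow> pd S i (\<lambda>y. f y + g y) x = pd S i f x + pd S i g x"
  by (intro pd_add x smooth_on_has_pd)

lemma pd_smooth_mult:
  "smooth_on S f \<Longrightarrow> smooth_on S g \<Longrightarrow> pd S i (\<lambda>y. f y * g y) x = pd S i f x * g x + f x * pd S i g x"
  by (intro pd_mult x smooth_on_has_pd)

lemma pd_smooth_minus: "smooth_on S f \<Longrightarrow> pd S i (\<lambda>y. - f y) x = - pd S i f x"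
  using pd_smooth_mult[of "\<lambda>y. - 1" f i] pd_const[OF x] by simp

lemma pd_smooth_diff:
  "smooth_on S f \<Longrightarrow> smooth_on S g \<Longrightarrow> pd S i (\<lambda>y. f y - g y) x = pd S i f x - pd S i g x"
  using pd_smooth_add[of f "\<lambda>y. - g y" i] by (simp add: pd_smooth_minus)

lemma pd_smooth_sum:
  "(\<And>a. smooth_on S (\<lambda>y. f y a)) \<Longrightarrow> pd S i (\<lambda>y. \<Sum>a\<in>B. f y a) x = (\<Sum>a\<in>B. pd S i (\<lambda>y. f y a) x)"
  by (induction B rule: infinite_finite_induct) (auto simp: pd_smooth_add pd_const x)

lemma pd_smooth_cmult:
  "smooth_on S f \<Longrightarrow> pd S i (\<lambda>y. c * f y) x = c * pd S i f x"
  by (simp add: pd_smooth_mult pd_const x)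

end

lemmas pd_smooth = pd_smooth_add pd_smooth_mult pd_smooth_minus pd_smooth_diff pd_smooth_sum pd_const

text \<open>Both sides are continuous on \<open>S\<close> and agree in the interior, whose closure
  contains \<open>S\<close>. This covers the initial time slice, where the time derivative is
  one-sided.\<close>

lemma pd_commute:
  assumes "smooth_on S f" "x \<in> S"
  shows "pd S i (\<lambda>y. pd S j f y) x = pd S j (\<lambda>y. pd S i f y) x"
proof -
  let ?d = "\<lambda>y. pd S i (pd S j f) y - pd S j (pd S i f) y"
  have "Ck_on 2 S f" using assms(1) by (simp add: smooth_on_def)
  then have z: "?d y = 0" if "y \<in> interior S" for y
    using pd_commute_interior[OF that] by simp
  have c: "continuous_on S ?d"
    by (intro smooth_on_continuous smooth_on_diff smooth_on_pd assms(1))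
  have "x \<in> closure (interior S)" using assms(2) subset_closure_interior by blast
  then obtain u where u: "\<And>n. u n \<in> interior S" "u \<longlonglongrightarrow> x"
    unfolding closure_sequential by auto
  have "(\<lambda>n. ?d (u n)) \<longlonglongrightarrow> ?d x"
    using continuous_on_tendsto_compose[OF c u(2) assms(2)] u(1) interior_subset[of S]
    by (auto intro!: always_eventually)
  then have "?d x = 0" using z[OF u(1)] by (simp add: LIMSEQ_const_iff)
  then show ?thesis by simp
qed

end

section \<open>Traces\<close>

text \<open>Keeping the contraction with the cometric as one linear operator lets long identities be
  traced term by term without expanding double sums.\<close>

definition gtrace :: "('m::finite \<Rightarrow> 'm \<Rightarrow> real) \<Rightarrow> ('m \<Rightarrow> 'm \<Rightarrow> real) \<Rightarrow> real" where
  "gtrace A F = (\<Sum>p\<in>UNIV. \<Sum>q\<in>UNIV. A p q * F p q)"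

lemma gtrace_add: "gtrace A (\<lambda>p q. E p q + F p q) = gtrace A E + gtrace A F"
  by (simp add: gtrace_def distrib_left sum.distrib)

lemma gtrace_diff: "gtrace A (\<lambda>p q. E p q - F p q) = gtrace A E - gtrace A F"
  by (simp add: gtrace_def right_diff_distrib sum_subtractf)

lemma gtrace_minus: "gtrace A (\<lambda>p q. - F p q) = - gtrace A F"
  by (simp add: gtrace_def sum_negf)

lemma gtrace_cmult: "gtrace A (\<lambda>p q. c * F p q) = c * gtrace A F"
  by (simp add: gtrace_def sum_distrib_left mult.left_commute)

lemma gtrace_cmult_right: "gtrace A (\<lambda>p q. F p q * c) = gtrace A F * c"
  by (simp add: gtrace_cmult mult.commute[of _ c])

lemma gtrace_sum: "gtrace A (\<lambda>p q. \<Sum>m\<in>B. F m p q) = (\<Sum>m\<in>B. gtrace A (F m))"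
  by (induction B rule: infinite_finite_induct) (auto simp: gtrace_add, auto simp: gtrace_def)

lemmas gtrace_linear = gtrace_add gtrace_diff gtrace_minus gtrace_sum gtrace_cmult

lemma gtrace_swap:
  "gtrace A (\<lambda>p q. gtrace B (\<lambda>k l. F p q k l)) = gtrace B (\<lambda>k l. gtrace A (\<lambda>p q. F p q k l))"
  by (simp add: gtrace_def[of A] gtrace_sum gtrace_cmult)

lemma gtrace_transpose:
  assumes "\<And>p q. A p q = A q p"
  shows "gtrace A (\<lambda>p q. F q p) = gtrace A F"
  unfolding gtrace_def by (subst sum.swap) (intro sum.cong refl arg_cong2[where f="(*)"] assms)

lemma sum_mult_assoc:
  fixes Z :: "_ \<Rightarrow> real"
  shows "(\<Sum>m\<in>B. (\<Sum>p\<in>C. X p * Y p m) * Z m) = (\<Sum>p\<in>C. X p * (\<Sum>m\<in>B. Y p m * Z m))"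
  by (simp add: sum_distrib_left sum_distrib_right mult.assoc) (rule sum.swap)

text \<open>Two contractions on different slots commute. This is what cancels the products of two
  Christoffel symbols in commutators of covariant derivatives.\<close>

lemma sum_mult_swap:
  fixes Z :: "_ \<Rightarrow> _ \<Rightarrow> real"
  shows "(\<Sum>p\<in>B. X p * (\<Sum>q\<in>C. Y q * Z p q)) = (\<Sum>q\<in>C. Y q * (\<Sum>p\<in>B. X p * Z p q))"
  by (simp add: sum_distrib_left mult.left_commute) (rule sum.swap)

lemmas sum_linear =
  distrib_left distrib_right right_diff_distrib left_diff_distrib
  sum.distrib sum_subtractf sum_negf minus_mult_left[symmetric] minus_mult_right[symmetric]


section \<open>Symmetric connections\<close>

definition cov4 ::
  "(real^'m::finite) set \<Rightarrow> 'm conn \<Rightarrow> (real^'m \<Rightarrow> 'm \<Rightarrow> 'm \<Rightarrow> 'm \<Rightarrow> 'm \<Rightarrow> real) \<Rightarrow>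
    real^'m \<Rightarrow> 'm \<Rightarrow> 'm \<Rightarrow> 'm \<Rightarrow> 'm \<Rightarrow> 'm \<Rightarrow> real" where
  "cov4 S \<Gamma> C x a k l i j = pd S a (\<lambda>y. C y k l i j) x
     - (\<Sum>p\<in>UNIV. \<Gamma> x a k p * C x p l i j)
     - (\<Sum>p\<in>UNIV. \<Gamma> x a l p * C x k p i j)
     - (\<Sum>p\<in>UNIV. \<Gamma> x a i p * C x k l p j)
     - (\<Sum>p\<in>UNIV. \<Gamma> x a j p * C x k l i p)"

text \<open>\<open>cov_riem S \<Gamma> x a l i j k\<close> is $\nabla_a R^l_{ijk}$.\<close>

definition cov_riem ::
  "(real^'m::finite) set \<Rightarrow> 'm conn \<Rightarrow> real^'m \<Rightarrow> 'm \<Rightarrow> 'm \<Rightarrow> 'm \<Rightarrow> 'm \<Rightarrow> 'm \<Rightarrow> real" where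
  "cov_riem S \<Gamma> x a l i j k = pd S a (\<lambda>y. riem S \<Gamma> y l i j k) x
     + (\<Sum>p\<in>UNIV. riem S \<Gamma> x p i j k * \<Gamma> x a p l)
     - (\<Sum>p\<in>UNIV. \<Gamma> x a i p * riem S \<Gamma> x l p j k)
     - (\<Sum>p\<in>UNIV. \<Gamma> x a j p * riem S \<Gamma> x l i p k)
     - (\<Sum>p\<in>UNIV. \<Gamma> x a k p * riem S \<Gamma> x l i j p)"

lemma riem_antisym: "riem S \<Gamma> x l i j k = - riem S \<Gamma> x l j i k"
  by (simp add: riem_def)

locale connection_on = pd_domain S for S :: "(real^'m::finite) set" +
  fixes \<Gamma> :: "'m conn"
  assumes conn_smooth [simp]: "smooth_on S (\<lambda>y. \<Gamma> y i j k)"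
    and conn_sym: "x \<in> S \<Longrightarrow> \<Gamma> x i j k = \<Gamma> x j i k"
begin

lemma smooth_on_cov2 [simp]:
  "(\<And>i j. smooth_on S (\<lambda>y. h y i j)) \<Longrightarrow> smooth_on S (\<lambda>y. cov2 S \<Gamma> h y a i j)"
  by (simp add: cov2_def)

lemma smooth_on_cov3 [simp]:
  "(\<And>k i j. smooth_on S (\<lambda>y. B y k i j)) \<Longrightarrow> smooth_on S (\<lambda>y. cov3 S \<Gamma> B y a k i j)"
  by (simp add: cov3_def)

lemma smooth_on_riem [simp]: "smooth_on S (\<lambda>y. riem S \<Gamma> y l i j k)"
  by (simp add: riem_def)

lemma smooth_on_ric [simp]: "smooth_on S (\<lambda>y. ric S \<Gamma> y j k)"
  by (simp add: ric_def)

lemma cov1_cong: "x \<in> S \<Longrightarrow> (\<And>y i. y \<in> S \<Longrightarrow> v y i = w y i) \<Longrightarrow> cov1 S \<Gamma> v x a j = cov1 S \<Gamma> w x a j"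
  unfolding cov1_def using pd_cong[of x S "\<lambda>y. v y j" "\<lambda>y. w y j" a] by simp

lemma cov2_cong:
  "x \<in> S \<Longrightarrow> (\<And>y i j. y \<in> S \<Longrightarrow> h y i j = h' y i j) \<Longrightarrow> cov2 S \<Gamma> h x a i j = cov2 S \<Gamma> h' x a i j"
  unfolding cov2_def using pd_cong[of x S "\<lambda>y. h y i j" "\<lambda>y. h' y i j" a] by simp

lemma cov2_diff:
  assumes "x \<in> S" "\<And>i j. smooth_on S (\<lambda>y. h y i j)" "\<And>i j. smooth_on S (\<lambda>y. h' y i j)"
  shows "cov2 S \<Gamma> (\<lambda>y i j. h y i j - h' y i j) x a i j = cov2 S \<Gamma> h x a i j - cov2 S \<Gamma> h' x a i j"
  by (simp add: cov2_def pd_smooth assms sum_linear)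

lemma cov2_cmult:
  assumes "x \<in> S" "\<And>i j. smooth_on S (\<lambda>y. h y i j)"
  shows "cov2 S \<Gamma> (\<lambda>y i j. c * h y i j) x a i j = c * cov2 S \<Gamma> h x a i j"
  by (simp add: cov2_def pd_smooth_cmult assms sum_distrib_left right_diff_distrib mult.left_commute)

text \<open>Symmetry of the connection removes the terms in \<Gamma>_ab^p, commuting partials
  removes the second derivatives of \<open>h\<close>, and the products acting on \<open>i\<close>
  and \<open>j\<close> at once cancel in pairs. What remains is curvature acting on each
  slot.\<close>

lemma ricci_identity2:
  assumes x: "x \<in> S" and h [simp]: "\<And>i j. smooth_on S (\<lambda>y. h y i j)"
  shows "cov3 S \<Gamma> (cov2 S \<Gamma> h) x a b i j - cov3 S \<Gamma> (cov2 S \<Gamma> h) x b a i j =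
    - (\<Sum>m\<in>UNIV. riem S \<Gamma> x m a b i * h x m j) - (\<Sum>m\<in>UNIV. riem S \<Gamma> x m a b j * h x i m)"
proof -
  have s: "\<Gamma> x b a p = \<Gamma> x a b p" for p by (rule conn_sym[OF x])
  have c: "pd S b (\<lambda>y. pd S a (\<lambda>z. h z i j) y) x = pd S a (\<lambda>y. pd S b (\<lambda>z. h z i j) y) x"
    by (rule pd_commute) (auto simp: x)
  show ?thesis
    using sum_mult_swap[where X="\<Gamma> x a i" and Y="\<Gamma> x b j" and Z="h x" and B=UNIV and C=UNIV]
      sum_mult_swap[where X="\<Gamma> x b i" and Y="\<Gamma> x a j" and Z="h x" and B=UNIV and C=UNIV]
    by (simp add: cov3_def cov2_def riem_def pd_smooth x c s sum_linear sum_mult_assoc)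
qed

lemma ricci_identity3:
  assumes x: "x \<in> S" and B [simp]: "\<And>k i j. smooth_on S (\<lambda>y. B y k i j)"
  shows "cov4 S \<Gamma> (cov3 S \<Gamma> B) x a b k i j - cov4 S \<Gamma> (cov3 S \<Gamma> B) x b a k i j =
    - (\<Sum>m\<in>UNIV. riem S \<Gamma> x m a b k * B x m i j)
    - (\<Sum>m\<in>UNIV. riem S \<Gamma> x m a b i * B x k m j)
    - (\<Sum>m\<in>UNIV. riem S \<Gamma> x m a b j * B x k i m)"
proof -
  have s: "\<Gamma> x b a p = \<Gamma> x a b p" for p by (rule conn_sym[OF x])
  have c: "pd S b (\<lambda>y. pd S a (\<lambda>z. B z k i j) y) x = pd S a (\<lambda>y. pd S b (\<lambda>z. B z k i j) y) x"
    by (rule pd_commute) (auto simp: x)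
  \<comment> \<open>The cross terms come from the three pairs among the slots \<open>k\<close>,
    \<open>i\<close>, \<open>j\<close>, each with \<open>a\<close> and \<open>b\<close> in either
    role; hence the six instances below.\<close>
  have sw: "(\<Sum>p\<in>UNIV. \<Gamma> x c u p * (\<Sum>q\<in>UNIV. \<Gamma> x d v q * Z p q)) =
      (\<Sum>q\<in>UNIV. \<Gamma> x d v q * (\<Sum>p\<in>UNIV. \<Gamma> x c u p * Z p q))" for c d u v and Z :: "'m \<Rightarrow> 'm \<Rightarrow> real"
    by (rule sum_mult_swap)
  show ?thesis
    by (simp only: cov4_def cov3_def riem_def pd_smooth x c s
        conn_smooth B smooth_on_sum smooth_on_mult smooth_on_pd smooth_on_diff)
      (simp only: sum_linear sum_mult_assoc
        sw[of a k b i "\<lambda>p q. B x p q j"] sw[of b k a i "\<lambda>p q. B x p q j"]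
        sw[of a k b j "\<lambda>p q. B x p i q"] sw[of b k a j "\<lambda>p q. B x p i q"]
        sw[of a i b j "\<lambda>p q. B x k p q"] sw[of b i a j "\<lambda>p q. B x k p q"])
qed

lemma bianchi1:
  assumes x: "x \<in> S"
  shows "riem S \<Gamma> x l i j k + riem S \<Gamma> x l j k i + riem S \<Gamma> x l k i j = 0"
proof -
  have s: "pd S c (\<lambda>y. \<Gamma> y u v l) x = pd S c (\<lambda>y. \<Gamma> y v u l) x" for c u v
    by (rule pd_cong[OF x]) (rule conn_sym)
  show ?thesis
    using s[of i j k] s[of j k i] s[of k i j] conn_sym[OF x, of i j] conn_sym[OF x, of j k]
      conn_sym[OF x, of k i]
    by (simp add: riem_def)
qed

lemma bianchi2:
  assumes x: "x \<in> S"
  shows "cov_riem S \<Gamma> x a l b c d + cov_riem S \<Gamma> x b l c a d + cov_riem S \<Gamma> x c l a b d = 0"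
proof -
  have s: "\<Gamma> x b a p = \<Gamma> x a b p" "\<Gamma> x c b p = \<Gamma> x b c p" "\<Gamma> x c a p = \<Gamma> x a c p" for p
    by (rule conn_sym[OF x])+
  have cm: "pd S u (\<lambda>y. pd S v (\<lambda>z. \<Gamma> z w d l) y) x = pd S v (\<lambda>y. pd S u (\<lambda>z. \<Gamma> z w d l) y) x" for u v w
    by (rule pd_commute) (auto simp: x)
  \<comment> \<open>Moving the summed index to the front turns the corrections of the two
    antisymmetric slots into terms that cancel in the cyclic sum by symmetry of the
    connection.\<close>
  have an: "(\<Sum>p\<in>UNIV. \<Gamma> x u v p * riem S \<Gamma> x l w p d) = - (\<Sum>p\<in>UNIV. \<Gamma> x u v p * riem S \<Gamma> x l p w d)" for u v w
    by (subst riem_antisym) (simp add: sum_negf)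
  have "cov_riem S \<Gamma> x u l v w d = pd S u (\<lambda>y. riem S \<Gamma> y l v w d) x
     + (\<Sum>p\<in>UNIV. riem S \<Gamma> x p v w d * \<Gamma> x u p l) - (\<Sum>p\<in>UNIV. \<Gamma> x u d p * riem S \<Gamma> x l v w p)
     - (\<Sum>p\<in>UNIV. \<Gamma> x u v p * riem S \<Gamma> x l p w d) + (\<Sum>p\<in>UNIV. \<Gamma> x u w p * riem S \<Gamma> x l p v d)" for u v w
    by (simp add: cov_riem_def an)
  note e = this[of a b c] this[of b c a] this[of c a b]
  show ?thesis
    unfolding e
    using cm[of a b c] cm[of b c a] cm[of c a b]
    by (simp add: s) (simp add: riem_def pd_smooth x sum_linear sum_mult_assoc)
qed

text \<open>For the contracted pair, the Christoffel correction of the upper index cancels that of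
  the lower one, so covariant differentiation commutes with this trace.\<close>

lemma cov_riem_trace:
  assumes x: "x \<in> S"
  shows "(\<Sum>l\<in>UNIV. cov_riem S \<Gamma> x a l l j k) = cov2 S \<Gamma> (ric S \<Gamma>) x a j k"
proof -
  have "(\<Sum>l\<in>UNIV. \<Sum>p\<in>UNIV. \<Gamma> x a l p * riem S \<Gamma> x l p j k) = (\<Sum>l\<in>UNIV. \<Sum>p\<in>UNIV. riem S \<Gamma> x p l j k * \<Gamma> x a p l)"
    by (subst sum.swap) (simp add: mult.commute)
  moreover have sw: "(\<Sum>l\<in>UNIV. \<Sum>p\<in>UNIV. \<Gamma> x a u p * F p l) = (\<Sum>p\<in>UNIV. \<Gamma> x a u p * (\<Sum>l\<in>UNIV. F p l))" for u F
    by (subst sum.swap) (simp add: sum_distrib_left)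
  ultimately show ?thesis
    using sw[of j "\<lambda>p l. riem S \<Gamma> x l l p k"] sw[of k "\<lambda>p l. riem S \<Gamma> x l l j p"]
    by (simp add: cov_riem_def cov2_def ric_def pd_smooth x sum_linear)
qed

lemma cov_riem_antisym:
  assumes x: "x \<in> S"
  shows "cov_riem S \<Gamma> x a l i j k = - cov_riem S \<Gamma> x a l j i k"
proof -
  have "pd S a (\<lambda>y. riem S \<Gamma> y l i j k) x = - pd S a (\<lambda>y. riem S \<Gamma> y l j i k) x"
    by (subst riem_antisym) (simp add: pd_smooth x)
  moreover have "(\<Sum>p\<in>UNIV. riem S \<Gamma> x p i j k * \<Gamma> x a p l) = - (\<Sum>p\<in>UNIV. riem S \<Gamma> x p j i k * \<Gamma> x a p l)"
    by (subst riem_antisym) (simp add: sum_negf)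
  moreover have "(\<Sum>p\<in>UNIV. \<Gamma> x a u p * riem S \<Gamma> x l p v k) = - (\<Sum>p\<in>UNIV. \<Gamma> x a u p * riem S \<Gamma> x l v p k)" for u v
    by (subst riem_antisym) (simp add: sum_negf)
  moreover have "(\<Sum>p\<in>UNIV. \<Gamma> x a k p * riem S \<Gamma> x l i j p) = - (\<Sum>p\<in>UNIV. \<Gamma> x a k p * riem S \<Gamma> x l j i p)"
    by (subst riem_antisym) (simp add: sum_negf)
  ultimately show ?thesis
    by (simp add: cov_riem_def)
qed

text \<open>In the second Bianchi identity the upper index is contracted with the derivative index.
  No metric is involved, so degeneracy of the cometric does no harm.\<close>

lemma contracted_bianchi2:
  assumes x: "x \<in> S"
  shows "(\<Sum>l\<in>UNIV. cov_riem S \<Gamma> x l l i j k) =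
    cov2 S \<Gamma> (ric S \<Gamma>) x i j k - cov2 S \<Gamma> (ric S \<Gamma>) x j i k"
proof -
  have "cov_riem S \<Gamma> x l l i j k = cov_riem S \<Gamma> x i l l j k - cov_riem S \<Gamma> x j l l i k" for l
    using bianchi2[OF x, of l l i j k] cov_riem_antisym[OF x, of i l j l k] by simp
  then show ?thesis by (simp add: sum_subtractf cov_riem_trace[OF x])
qed

end

section \<open>Parallel cometrics\<close>

text \<open>The cometric may be degenerate, so there is no lowering of indices.\<close>

locale metric_connection = connection_on S \<Gamma> for S :: "(real^'m::finite) set" and \<Gamma> +
  fixes G :: "'m form2"
  assumes metric_smooth [simp]: "smooth_on S (\<lambda>y. G y i j)"
    and metric_sym: "x \<in> S \<Longrightarrow> G x i j = G x j i"
    and metric_parallel: "x \<in> S \<Longrightarrow> pd S a (\<lambda>y. G y i j) x =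
      - (\<Sum>p\<in>UNIV. \<Gamma> x a p i * G x p j) - (\<Sum>p\<in>UNIV. \<Gamma> x a p j * G x i p)"
begin

lemma smooth_on_gtrace [simp]:
  "(\<And>p q. smooth_on S (\<lambda>y. F y p q)) \<Longrightarrow> smooth_on S (\<lambda>y. gtrace (G y) (\<lambda>p q. F y p q))"
  by (simp add: gtrace_def)

text \<open>The derivative of \<open>G\<close> supplies exactly the Christoffel corrections for the
  traced slots: a parallel cometric passes through differentiation.\<close>

lemma pd_gtrace:
  assumes x: "x \<in> S" and F [simp]: "\<And>p q. smooth_on S (\<lambda>y. F y p q)"
  shows "pd S a (\<lambda>y. gtrace (G y) (\<lambda>p q. F y p q)) x = gtrace (G x) (\<lambda>p q. cov2 S \<Gamma> F x a p q)"
proof -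
  have "(\<Sum>p\<in>UNIV. \<Sum>q\<in>UNIV. (\<Sum>r\<in>UNIV. \<Gamma> x a r p * G x r q) * F x p q)
      = (\<Sum>p\<in>UNIV. \<Sum>q\<in>UNIV. G x p q * (\<Sum>r\<in>UNIV. \<Gamma> x a p r * F x r q))"
  proof -
    have "(\<Sum>p\<in>UNIV. \<Sum>q\<in>UNIV. (\<Sum>r\<in>UNIV. \<Gamma> x a r p * G x r q) * F x p q)
        = (\<Sum>q\<in>UNIV. \<Sum>p\<in>UNIV. \<Sum>r\<in>UNIV. \<Gamma> x a r p * G x r q * F x p q)"
      by (subst sum.swap) (simp add: sum_distrib_right)
    also have "\<dots> = (\<Sum>q\<in>UNIV. \<Sum>r\<in>UNIV. \<Sum>p\<in>UNIV. \<Gamma> x a r p * G x r q * F x p q)"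
      by (intro sum.cong refl sum.swap)
    also have "\<dots> = (\<Sum>r\<in>UNIV. \<Sum>q\<in>UNIV. \<Sum>p\<in>UNIV. \<Gamma> x a r p * G x r q * F x p q)"
      by (rule sum.swap)
    finally show ?thesis by (simp add: sum_distrib_left ac_simps)
  qed
  moreover have "(\<Sum>q\<in>UNIV. (\<Sum>r\<in>UNIV. \<Gamma> x a r q * G x p r) * F x p q)
      = (\<Sum>q\<in>UNIV. G x p q * (\<Sum>r\<in>UNIV. \<Gamma> x a q r * F x p r))" for p
    by (simp add: sum_distrib_right sum_distrib_left ac_simps) (rule sum.swap)
  ultimately show ?thesis
    by (simp add: gtrace_def cov2_def pd_smooth x metric_parallel sum_linear)
qed

lemma cov1_gtrace:
  assumes x: "x \<in> S" and B [simp]: "\<And>p q j. smooth_on S (\<lambda>y. B y p q j)"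
  shows "cov1 S \<Gamma> (\<lambda>y j. gtrace (G y) (\<lambda>p q. B y p q j)) x a j
    = gtrace (G x) (\<lambda>p q. cov3 S \<Gamma> B x a p q j)"
  by (simp add: cov1_def cov2_def cov3_def pd_gtrace[OF x, of "\<lambda>y p q. B y p q j"] gtrace_linear)

lemma cov2_gtrace:
  assumes x: "x \<in> S" and C [simp]: "\<And>p q i j. smooth_on S (\<lambda>y. C y p q i j)"
  shows "cov2 S \<Gamma> (\<lambda>y i j. gtrace (G y) (\<lambda>p q. C y p q i j)) x a i j
    = gtrace (G x) (\<lambda>p q. cov4 S \<Gamma> C x a p q i j)"
  by (simp add: cov2_def[of S \<Gamma> "\<lambda>y i j. gtrace (G y) (\<lambda>p q. C y p q i j)"]
      cov2_def[of S \<Gamma> "\<lambda>y p q. C y p q i j"] cov4_def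
      pd_gtrace[OF x, of "\<lambda>y p q. C y p q i j"] gtrace_linear)

lemma cov2_gtrace13:
  assumes x: "x \<in> S" and C [simp]: "\<And>p q i j. smooth_on S (\<lambda>y. C y p q i j)"
  shows "cov2 S \<Gamma> (\<lambda>y i j. gtrace (G y) (\<lambda>p q. C y p i q j)) x a i j
    = gtrace (G x) (\<lambda>p q. cov4 S \<Gamma> C x a p i q j)"
  using cov2_gtrace[OF x, of "\<lambda>y p q i j. C y p i q j" a i j]
  by (simp add: cov4_def)
    (simp add: gtrace_linear)

text \<open>The curvature operator annihilates the parallel tensor \<open>G\<close>: writing
  derivatives of \<open>G\<close> through Christoffel symbols and commuting two of them gives the
  claim. It stands in for R_ijkl = -R_ijlk.\<close>

lemma riem_raised_antisym:
  assumes x: "x \<in> S"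
  shows "(\<Sum>m\<in>UNIV. G x k m * riem S \<Gamma> x l i j m) = - (\<Sum>m\<in>UNIV. G x l m * riem S \<Gamma> x k i j m)"
proof -
  have c: "pd S i (\<lambda>y. pd S j (\<lambda>z. G z k l) y) x = pd S j (\<lambda>y. pd S i (\<lambda>z. G z k l) y) x"
    by (rule pd_commute) (auto simp: x)
  have d: "pd S i (\<lambda>y. pd S j (\<lambda>z. G z k l) y) x = pd S i (\<lambda>y. - (\<Sum>p\<in>UNIV. \<Gamma> y j p k * G y p l) - (\<Sum>p\<in>UNIV. \<Gamma> y j p l * G y k p)) x" for i j
    by (rule pd_cong[OF x]) (rule metric_parallel)
  have e: "(\<Sum>p\<in>UNIV. pd S i (\<lambda>y. \<Gamma> y j p k) x * G x p l + \<Gamma> x j p k * (- (\<Sum>q\<in>UNIV. \<Gamma> x i q p * G x q l) - (\<Sum>q\<in>UNIV. \<Gamma> x i q l * G x p q)))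
     + (\<Sum>p\<in>UNIV. pd S i (\<lambda>y. \<Gamma> y j p l) x * G x k p + \<Gamma> x j p l * (- (\<Sum>q\<in>UNIV. \<Gamma> x i q k * G x q p) - (\<Sum>q\<in>UNIV. \<Gamma> x i q p * G x k q)))
     = (\<Sum>p\<in>UNIV. pd S j (\<lambda>y. \<Gamma> y i p k) x * G x p l + \<Gamma> x i p k * (- (\<Sum>q\<in>UNIV. \<Gamma> x j q p * G x q l) - (\<Sum>q\<in>UNIV. \<Gamma> x j q l * G x p q)))
     + (\<Sum>p\<in>UNIV. pd S j (\<lambda>y. \<Gamma> y i p l) x * G x k p + \<Gamma> x i p l * (- (\<Sum>q\<in>UNIV. \<Gamma> x j q k * G x q p) - (\<Sum>q\<in>UNIV. \<Gamma> x j q p * G x k q)))"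
    using c unfolding d by (simp add: pd_smooth x metric_parallel)
  \<comment> \<open>Products with one coefficient acting on \<open>k\<close> and the other on
    \<open>l\<close> are symmetric under exchange of \<open>i\<close> and \<open>j\<close> and drop
    out; those acting twice on the same index form the quadratic part of the curvature.\<close>
  have cross: "(\<Sum>p\<in>UNIV. \<Gamma> x u p k * (\<Sum>q\<in>UNIV. \<Gamma> x v q l * G x p q)) = (\<Sum>p\<in>UNIV. \<Gamma> x v p l * (\<Sum>q\<in>UNIV. \<Gamma> x u q k * G x q p))" for u v
    by (rule sum_mult_swap)
  have comp_k: "(\<Sum>p\<in>UNIV. \<Gamma> x u p k * (\<Sum>q\<in>UNIV. \<Gamma> x v q p * G x q l)) = (\<Sum>q\<in>UNIV. G x l q * (\<Sum>p\<in>UNIV. \<Gamma> x v q p * \<Gamma> x u p k))" for u v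
    by (simp add: metric_sym[OF x, of l] sum_distrib_left ac_simps) (rule sum.swap)
  have comp_l: "(\<Sum>p\<in>UNIV. \<Gamma> x u p l * (\<Sum>q\<in>UNIV. \<Gamma> x v q p * G x k q)) = (\<Sum>q\<in>UNIV. G x k q * (\<Sum>p\<in>UNIV. \<Gamma> x v q p * \<Gamma> x u p l))" for u v
    by (simp add: sum_distrib_left ac_simps) (rule sum.swap)
  have "(\<Sum>p\<in>UNIV. pd S u (\<lambda>y. \<Gamma> y v p w) x * G x p l) = (\<Sum>p\<in>UNIV. G x l p * pd S u (\<lambda>y. \<Gamma> y v p w) x)"
    "(\<Sum>p\<in>UNIV. pd S u (\<lambda>y. \<Gamma> y v p w) x * G x k p) = (\<Sum>p\<in>UNIV. G x k p * pd S u (\<lambda>y. \<Gamma> y v p w) x)" for u v w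
    by (simp_all add: metric_sym[OF x, of l] mult.commute)
  then show ?thesis
    using e cross[of i j] cross[of j i]
    by (simp only: sum_linear comp_k comp_l riem_def)
qed

text \<open>The raised antisymmetry exchanges the upper index with the traced one, which leaves a
  Ricci contraction. For a steady connection the right-hand side is \<Gamma>_a\<tau>^m, and in this
  way the curvature terms of commutators meet the Christoffel terms of the time direction.\<close>

lemma riem_contracted:
  assumes x: "x \<in> S"
  shows "gtrace (G x) (\<lambda>p q. riem S \<Gamma> x m p a q) = - (\<Sum>q\<in>UNIV. G x m q * ric S \<Gamma> x a q)"
proof -
  have "gtrace (G x) (\<lambda>p q. riem S \<Gamma> x m p a q) = - (\<Sum>p\<in>UNIV. \<Sum>q\<in>UNIV. G x m q * riem S \<Gamma> x p p a q)"
    by (simp add: gtrace_def riem_raised_antisym[OF x, of _ m] sum_negf)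
  also have "(\<Sum>p\<in>UNIV. \<Sum>q\<in>UNIV. G x m q * riem S \<Gamma> x p p a q) = (\<Sum>q\<in>UNIV. G x m q * ric S \<Gamma> x a q)"
    by (subst sum.swap) (simp add: ric_def sum_distrib_left)
  finally show ?thesis .
qed

text \<open>As \<open>G\<close> is parallel, raising an index commutes with covariant
  differentiation, so the derivative inherits the antisymmetry of the raised curvature
  \<open>E\<close>.\<close>

lemma cov_riem_raised_antisym:
  assumes x: "x \<in> S"
  shows "(\<Sum>m\<in>UNIV. G x k m * cov_riem S \<Gamma> x a l i j m) = - (\<Sum>m\<in>UNIV. G x l m * cov_riem S \<Gamma> x a k i j m)"
proof -
  define E where "E y k l i j = (\<Sum>m\<in>UNIV. G y k m * riem S \<Gamma> y l i j m)" for y k l i j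
  have E: "E y k l i j = - E y l k i j" if "y \<in> S" for y k l i j
    unfolding E_def by (rule riem_raised_antisym[OF that])
  have [simp]: "smooth_on S (\<lambda>y. E y k l i j)" for k l i j
    by (simp add: E_def)
  have D: "(\<Sum>m\<in>UNIV. G x k m * cov_riem S \<Gamma> x a l i j m) = pd S a (\<lambda>y. E y k l i j) x
      + (\<Sum>p\<in>UNIV. \<Gamma> x a p k * E x p l i j) + (\<Sum>p\<in>UNIV. \<Gamma> x a p l * E x k p i j)
      - (\<Sum>p\<in>UNIV. \<Gamma> x a i p * E x k l p j) - (\<Sum>p\<in>UNIV. \<Gamma> x a j p * E x k l i p)" for k l
  proof -
    have 1: "(\<Sum>m\<in>UNIV. (\<Sum>p\<in>UNIV. \<Gamma> x a p k * G x p m) * riem S \<Gamma> x l i j m) = (\<Sum>p\<in>UNIV. \<Gamma> x a p k * E x p l i j)"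
      unfolding E_def by (rule sum_mult_assoc)
    have 2: "(\<Sum>m\<in>UNIV. (\<Sum>p\<in>UNIV. \<Gamma> x a p m * G x k p) * riem S \<Gamma> x l i j m) = (\<Sum>m\<in>UNIV. G x k m * (\<Sum>p\<in>UNIV. \<Gamma> x a m p * riem S \<Gamma> x l i j p))"
      by (simp add: sum_distrib_left sum_distrib_right ac_simps) (rule sum.swap)
    have 3: "(\<Sum>m\<in>UNIV. G x k m * (\<Sum>p\<in>UNIV. \<Gamma> x a u p * F p m)) = (\<Sum>p\<in>UNIV. \<Gamma> x a u p * (\<Sum>m\<in>UNIV. G x k m * F p m))" for u F
      by (rule sum_mult_swap)
    have 4: "(\<Sum>m\<in>UNIV. G x k m * (\<Sum>p\<in>UNIV. riem S \<Gamma> x p i j m * \<Gamma> x a p l)) = (\<Sum>p\<in>UNIV. \<Gamma> x a p l * E x k p i j)"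
      unfolding E_def by (subst sum_mult_swap[symmetric]) (simp add: mult.commute)
    show ?thesis
      using 1 2 4 3[of i "\<lambda>p m. riem S \<Gamma> x l p j m"] 3[of j "\<lambda>p m. riem S \<Gamma> x l i p m"]
      by (simp add: E_def pd_smooth x metric_parallel cov_riem_def sum_linear)
  qed
  have "pd S a (\<lambda>y. E y k l i j) x = pd S a (\<lambda>y. - E y l k i j) x"
    by (rule pd_cong[OF x]) (rule E)
  then show ?thesis
    unfolding D by (simp add: pd_smooth x E[OF x, of k] E[OF x, of _ l] sum_negf)
qed

text \<open>The term $h_{pq} R^q_{pij}$.\<close>

definition curv :: "'m form2 \<Rightarrow> 'm form2" where
  "curv h x i j = gtrace (G x) (\<lambda>p r. \<Sum>q\<in>UNIV. h x r q * riem S \<Gamma> x q p i j)"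

lemma riem_term_eq_curv: "riem_term S G \<Gamma> h x i j = curv h x i j"
  unfolding riem_term_def curv_def gtrace_def
  by (rule sum.cong[OF refl], subst sum.swap) (simp add: sum_distrib_left mult.assoc)

lemma smooth_on_curv [simp]:
  "(\<And>i j. smooth_on S (\<lambda>y. h y i j)) \<Longrightarrow> smooth_on S (\<lambda>y. curv h y i j)"
  by (simp add: curv_def)

text \<open>By the first Bianchi identity the two orders differ by a contraction of \<open>h\<close>
  with R^q_ijp. Once \<open>p\<close> is raised this curvature is antisymmetric in \<open>p\<close>
  and \<open>q\<close>, and it is paired with a symmetric tensor.\<close>

lemma curv_sym:
  assumes x: "x \<in> S" and h: "\<And>i j. h x i j = h x j i"
  shows "curv h x i j = curv h x j i"
proof -
  have b: "riem S \<Gamma> x q p i j = riem S \<Gamma> x q p j i - riem S \<Gamma> x q i j p" for q p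
    using bianchi1[OF x, of q p i j] riem_antisym[of S \<Gamma> x q j p i] by simp
  have *: "gtrace (G x) (\<lambda>p r. \<Sum>q\<in>UNIV. h x r q * riem S \<Gamma> x q i j p)
      = (\<Sum>r\<in>UNIV. \<Sum>q\<in>UNIV. h x r q * (\<Sum>p\<in>UNIV. G x r p * riem S \<Gamma> x q i j p))"
  proof -
    have "gtrace (G x) (\<lambda>p r. \<Sum>q\<in>UNIV. h x r q * riem S \<Gamma> x q i j p)
      = (\<Sum>r\<in>UNIV. \<Sum>p\<in>UNIV. G x r p * (\<Sum>q\<in>UNIV. h x r q * riem S \<Gamma> x q i j p))"
      unfolding gtrace_def by (subst sum.swap) (simp add: metric_sym[OF x])
    also have "\<dots> = (\<Sum>r\<in>UNIV. \<Sum>q\<in>UNIV. h x r q * (\<Sum>p\<in>UNIV. G x r p * riem S \<Gamma> x q i j p))"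
      by (intro sum.cong refl sum_mult_swap)
    finally show ?thesis .
  qed
  have "(\<Sum>r\<in>UNIV. \<Sum>q\<in>UNIV. h x r q * (\<Sum>p\<in>UNIV. G x r p * riem S \<Gamma> x q i j p))
      = (\<Sum>r\<in>UNIV. \<Sum>q\<in>UNIV. - (h x q r * (\<Sum>p\<in>UNIV. G x q p * riem S \<Gamma> x r i j p)))"
    by (intro sum.cong refl) (subst riem_raised_antisym[OF x], simp add: h)
  also have "\<dots> = - (\<Sum>r\<in>UNIV. \<Sum>q\<in>UNIV. h x r q * (\<Sum>p\<in>UNIV. G x r p * riem S \<Gamma> x q i j p))"
    by (subst sum.swap) (simp add: sum_negf)
  finally have "gtrace (G x) (\<lambda>p r. \<Sum>q\<in>UNIV. h x r q * riem S \<Gamma> x q i j p) = 0"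
    using * by simp
  then show ?thesis
    unfolding curv_def by (subst b) (simp add: right_diff_distrib sum_subtractf gtrace_linear)
qed

text \<open>Leibniz rule: \<open>q\<close> stands below in \<open>h\<close> and above in the
  curvature, so its two Christoffel corrections cancel, and the remaining trace is parallel.\<close>

lemma cov2_curv:
  assumes x: "x \<in> S" and h [simp]: "\<And>i j. smooth_on S (\<lambda>y. h y i j)"
  shows "cov2 S \<Gamma> (curv h) x a i j = gtrace (G x) (\<lambda>p r. \<Sum>q\<in>UNIV.
    cov2 S \<Gamma> h x a r q * riem S \<Gamma> x q p i j + h x r q * cov_riem S \<Gamma> x a q p i j)"
proof -
  let ?C = "\<lambda>y p r i j. \<Sum>q\<in>UNIV. h y r q * riem S \<Gamma> y q p i j"
  have "cov4 S \<Gamma> ?C x a p r i j = (\<Sum>q\<in>UNIV.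
    cov2 S \<Gamma> h x a r q * riem S \<Gamma> x q p i j + h x r q * cov_riem S \<Gamma> x a q p i j)" for p r
  proof -
    have 1: "(\<Sum>q\<in>UNIV. h x r q * (\<Sum>s\<in>UNIV. riem S \<Gamma> x s p i j * \<Gamma> x a s q)) = (\<Sum>q\<in>UNIV. (\<Sum>s\<in>UNIV. \<Gamma> x a q s * h x r s) * riem S \<Gamma> x q p i j)"
      by (simp add: sum_distrib_left sum_distrib_right ac_simps) (rule sum.swap)
    have 2: "(\<Sum>s\<in>UNIV. \<Gamma> x a r s * (\<Sum>q\<in>UNIV. h x s q * riem S \<Gamma> x q p i j)) = (\<Sum>q\<in>UNIV. (\<Sum>s\<in>UNIV. \<Gamma> x a r s * h x s q) * riem S \<Gamma> x q p i j)"
      by (rule sum_mult_assoc[symmetric])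
    have 3: "(\<Sum>s\<in>UNIV. \<Gamma> x a u s * (\<Sum>q\<in>UNIV. h x r q * F s q)) = (\<Sum>q\<in>UNIV. h x r q * (\<Sum>s\<in>UNIV. \<Gamma> x a u s * F s q))" for u F
      by (rule sum_mult_swap)
    show ?thesis
      using 1 2 3[of p "\<lambda>s q. riem S \<Gamma> x q s i j"] 3[of i "\<lambda>s q. riem S \<Gamma> x q p s j"]
        3[of j "\<lambda>s q. riem S \<Gamma> x q p i s"]
      by (simp add: cov4_def cov2_def cov_riem_def pd_smooth x sum_linear)
  qed
  then show ?thesis
    using cov2_gtrace[OF x, of ?C a i j] by (simp add: curv_def[abs_def])
qed

end

section \<open>Curvature components with a time index\<close>

context metric_connection
begin

text \<open>R^m_pj\<tau> is the commutator of \<nabla>_p and \<nabla>_j on \<partial>_\<tau>, whose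
  first derivative is -G^ml R_al with \<open>G\<close> parallel. The relation is assumed for the two
  indices \<open>p\<close> and \<open>j\<close> only, so that the lemma can serve before the
  relation is known in the direction \<open>\<tau>\<close>.\<close>

lemma riem_time_index:
  assumes x: "x \<in> S"
    and t: "\<And>y k. y \<in> S \<Longrightarrow> \<Gamma> y p \<tau> k = - (\<Sum>l\<in>UNIV. G y k l * ric S \<Gamma> y p l)"
      "\<And>y k. y \<in> S \<Longrightarrow> \<Gamma> y j \<tau> k = - (\<Sum>l\<in>UNIV. G y k l * ric S \<Gamma> y j l)"
  shows "riem S \<Gamma> x m p j \<tau> = (\<Sum>q\<in>UNIV. G x m q *
    (cov2 S \<Gamma> (ric S \<Gamma>) x j p q - cov2 S \<Gamma> (ric S \<Gamma>) x p j q))"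
proof -
  have s: "\<Gamma> x p j q = \<Gamma> x j p q" for q by (rule conn_sym[OF x])
  have d: "pd S u (\<lambda>y. \<Gamma> y p \<tau> m) x = pd S u (\<lambda>y. - (\<Sum>l\<in>UNIV. G y m l * ric S \<Gamma> y p l)) x"
    "pd S u (\<lambda>y. \<Gamma> y j \<tau> m) x = pd S u (\<lambda>y. - (\<Sum>l\<in>UNIV. G y m l * ric S \<Gamma> y j l)) x" for u
    by (rule pd_cong[OF x], rule t, assumption)+
  have 1: "(\<Sum>l\<in>UNIV. (\<Sum>s\<in>UNIV. \<Gamma> x u s m * G x s l) * ric S \<Gamma> x v l)
      = (\<Sum>s\<in>UNIV. \<Gamma> x u s m * (\<Sum>l\<in>UNIV. G x s l * ric S \<Gamma> x v l))" for u v
    by (rule sum_mult_assoc)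
  have 2: "(\<Sum>l\<in>UNIV. (\<Sum>s\<in>UNIV. \<Gamma> x u s l * G x m s) * ric S \<Gamma> x v l)
      = (\<Sum>l\<in>UNIV. G x m l * (\<Sum>s\<in>UNIV. \<Gamma> x u l s * ric S \<Gamma> x v s))" for u v
    by (simp add: sum_distrib_left sum_distrib_right ac_simps) (rule sum.swap)
  have 3: "(\<Sum>s\<in>UNIV. \<Gamma> x p \<tau> s * \<Gamma> x u s m) = - (\<Sum>s\<in>UNIV. \<Gamma> x u s m * (\<Sum>l\<in>UNIV. G x s l * ric S \<Gamma> x p l))"
    "(\<Sum>s\<in>UNIV. \<Gamma> x j \<tau> s * \<Gamma> x u s m) = - (\<Sum>s\<in>UNIV. \<Gamma> x u s m * (\<Sum>l\<in>UNIV. G x s l * ric S \<Gamma> x j l))" for u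
    by (simp_all add: t[OF x] mult.commute[of "\<Gamma> x u _ m"] sum_negf)
  show ?thesis
    using 1[of p j] 1[of j p] 2[of p j] 2[of j p] 3(2)[of p] 3(1)[of j]
    by (simp add: riem_def[of S \<Gamma> x m p j \<tau>] d pd_smooth x metric_parallel cov2_def s sum_linear)
qed

text \<open>The trace of \<open>contracted_bianchi2\<close> is \<partial>_i R minus the divergence
  of Ricci. The raised antisymmetry, followed by antisymmetry in the first pair, shows that this
  same trace is the divergence itself; hence the factor 2.\<close>

lemma div_ric:
  assumes x: "x \<in> S"
  shows "2 * gtrace (G x) (\<lambda>j m. cov2 S \<Gamma> (ric S \<Gamma>) x j i m)
    = pd S i (\<lambda>y. gtrace (G y) (ric S \<Gamma> y)) x"
proof -
  have "gtrace (G x) (\<lambda>j m. \<Sum>k\<in>UNIV. cov_riem S \<Gamma> x k k i j m)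
      = (\<Sum>k\<in>UNIV. \<Sum>j\<in>UNIV. \<Sum>m\<in>UNIV. G x j m * cov_riem S \<Gamma> x k k i j m)"
    by (simp add: gtrace_sum) (simp add: gtrace_def)
  also have "\<dots> = (\<Sum>k\<in>UNIV. \<Sum>j\<in>UNIV. \<Sum>m\<in>UNIV. G x k m * cov_riem S \<Gamma> x k j j i m)"
    using cov_riem_raised_antisym[OF x, of j k k i j for j k] cov_riem_antisym[OF x, of k j i j for k j]
    by (simp add: sum_negf)
  also have "\<dots> = (\<Sum>k\<in>UNIV. \<Sum>m\<in>UNIV. G x k m * (\<Sum>j\<in>UNIV. cov_riem S \<Gamma> x k j j i m))"
    by (simp add: sum_distrib_left) (intro sum.cong refl sum.swap)
  also have "\<dots> = gtrace (G x) (\<lambda>k m. cov2 S \<Gamma> (ric S \<Gamma>) x k i m)"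
    by (simp add: gtrace_def cov_riem_trace[OF x])
  finally show ?thesis
    using pd_gtrace[OF x, of "ric S \<Gamma>" i]
    by (simp add: contracted_bianchi2[OF x] gtrace_diff)
qed

text \<open>The first Bianchi identity and the vanishing last trace move \<open>\<tau>\<close> to
  the last slot, where \<open>riem_time_index\<close> expresses the curvature by derivatives of
  Ricci. The two traces are \<partial>_l R and, by \<open>div_ric\<close>, half of it. The soliton
  relation enters only for indices other than \<open>\<tau>\<close>, since the result serves to
  prove it at \<open>\<tau>\<close>.\<close>

lemma ric_time_index:
  assumes x: "x \<in> S" and l: "l \<noteq> \<tau>"
    and t: "\<And>y a k. y \<in> S \<Longrightarrow> a \<noteq> \<tau> \<Longrightarrow> \<Gamma> y a \<tau> k = - (\<Sum>l\<in>UNIV. G y k l * ric S \<Gamma> y a l)"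
    and G0: "\<And>k. G x \<tau> k = 0" and R0: "riem S \<Gamma> x \<tau> \<tau> l \<tau> = 0"
    and tr: "(\<Sum>p\<in>UNIV. riem S \<Gamma> x p \<tau> l p) = 0"
  shows "ric S \<Gamma> x \<tau> l = 1 / 2 * pd S l (\<lambda>y. gtrace (G y) (ric S \<Gamma> y)) x"
proof -
  have "riem S \<Gamma> x p p \<tau> l = riem S \<Gamma> x p p l \<tau> - riem S \<Gamma> x p \<tau> l p" for p
    using bianchi1[OF x, of p p \<tau> l] riem_antisym[of S \<Gamma> x p l p \<tau>] by simp
  then have "ric S \<Gamma> x \<tau> l = (\<Sum>p\<in>UNIV. riem S \<Gamma> x p p l \<tau>)"
    by (simp add: ric_def sum_subtractf tr)
  moreover have "riem S \<Gamma> x p p l \<tau> = (\<Sum>q\<in>UNIV. G x p q *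
      (cov2 S \<Gamma> (ric S \<Gamma>) x l p q - cov2 S \<Gamma> (ric S \<Gamma>) x p l q))" for p
    using riem_time_index[OF x, of p \<tau> l p] t l G0 R0 by (cases "p = \<tau>") auto
  ultimately have "ric S \<Gamma> x \<tau> l = gtrace (G x) (\<lambda>p q. cov2 S \<Gamma> (ric S \<Gamma>) x l p q)
      - gtrace (G x) (\<lambda>p q. cov2 S \<Gamma> (ric S \<Gamma>) x p l q)"
    by (simp add: gtrace_def sum_linear)
  then show ?thesis
    using pd_gtrace[OF x, of "ric S \<Gamma>" l] div_ric[OF x, of l] by simp
qed

end

text \<open>A connection for which $\nabla_a (\partial_\tau)^k = -G^{kl} R_{al}$, as on a steady soliton.\<close>

locale steady_connection = metric_connection S \<Gamma> G for S :: "(real^'m::finite) set" and \<Gamma> G +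
  fixes \<tau> :: 'm
  assumes conn_time: "x \<in> S \<Longrightarrow> \<Gamma> x a \<tau> k = - (\<Sum>l\<in>UNIV. G x k l * ric S \<Gamma> x a l)"
begin

lemma riem_time:
  "x \<in> S \<Longrightarrow> riem S \<Gamma> x m p j \<tau> = (\<Sum>q\<in>UNIV. G x m q *
    (cov2 S \<Gamma> (ric S \<Gamma>) x j p q - cov2 S \<Gamma> (ric S \<Gamma>) x p j q))"
  by (rule riem_time_index) (auto intro: conn_time)

section \<open>Symmetric 2-tensors whose time components are their divergence\<close>

context
  fixes h :: "'m form2"
  assumes h_smooth [simp]: "smooth_on S (\<lambda>y. h y i j)"
    and h_sym: "x \<in> S \<Longrightarrow> h x i j = h x j i"
    and h_time: "x \<in> S \<Longrightarrow> h x \<tau> j = gtrace (G x) (\<lambda>p q. cov2 S \<Gamma> h x p q j)"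
begin

text \<open>Commuting the derivatives yields a Ricci term, and differentiating
  \<open>h x \<tau> j\<close> as a 1-form rather than as a component of a 2-tensor yields a term in
  \<Gamma>_a\<tau>^p. On a steady connection these cancel and only \<open>curv\<close>
  survives.\<close>

lemma trace_cov3_cov2:
  assumes x: "x \<in> S"
  shows "gtrace (G x) (\<lambda>p q. cov3 S \<Gamma> (cov2 S \<Gamma> h) x p a q j) = cov2 S \<Gamma> h x a \<tau> j - curv h x a j"
proof -
  have "cov1 S \<Gamma> (\<lambda>y j. gtrace (G y) (\<lambda>p q. cov2 S \<Gamma> h y p q j)) x a j = cov1 S \<Gamma> (\<lambda>y j. h y \<tau> j) x a j"
    by (rule cov1_cong[OF x]) (simp add: h_time)
  then have 1: "gtrace (G x) (\<lambda>p q. cov3 S \<Gamma> (cov2 S \<Gamma> h) x a p q j) =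
      cov2 S \<Gamma> h x a \<tau> j + (\<Sum>p\<in>UNIV. \<Gamma> x a \<tau> p * h x p j)"
    by (simp add: cov1_gtrace[OF x]) (simp add: cov1_def cov2_def)
  have 2: "gtrace (G x) (\<lambda>p q. \<Sum>m\<in>UNIV. riem S \<Gamma> x m p a q * h x m j) = (\<Sum>p\<in>UNIV. \<Gamma> x a \<tau> p * h x p j)"
    by (simp add: gtrace_sum gtrace_cmult_right riem_contracted[OF x] conn_time[OF x])
  have 3: "gtrace (G x) (\<lambda>p q. \<Sum>m\<in>UNIV. riem S \<Gamma> x m p a j * h x q m) = curv h x a j"
    by (simp add: curv_def mult.commute)
  have "cov3 S \<Gamma> (cov2 S \<Gamma> h) x p a q j = cov3 S \<Gamma> (cov2 S \<Gamma> h) x a p q j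
      - (\<Sum>m\<in>UNIV. riem S \<Gamma> x m p a q * h x m j) - (\<Sum>m\<in>UNIV. riem S \<Gamma> x m p a j * h x q m)" for p q
    using ricci_identity2[OF x, of h p a q j] by simp
  then show ?thesis
    using 1 2 3 by (simp add: gtrace_diff)
qed

lemma cov2_sym: "x \<in> S \<Longrightarrow> cov2 S \<Gamma> h x a i j = cov2 S \<Gamma> h x a j i"
  using pd_cong[of x S "\<lambda>y. h y i j" "\<lambda>y. h y j i" a] h_sym
  by (simp add: cov2_def)

lemma laplace2_sym:
  assumes x: "x \<in> S"
  shows "laplace2 S G \<Gamma> h x i j = laplace2 S G \<Gamma> h x j i"
proof -
  have "cov3 S \<Gamma> (cov2 S \<Gamma> h) x k l i j = cov3 S \<Gamma> (cov2 S \<Gamma> h) x k l j i" for k l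
    using pd_cong[OF x, of "\<lambda>y. cov2 S \<Gamma> h y l i j" "\<lambda>y. cov2 S \<Gamma> h y l j i" k]
    by (simp add: cov3_def cov2_sym[OF x, of _ i] cov2_sym[OF x, of _ _ j] cov2_sym)
  then show ?thesis by (simp add: laplace2_def)
qed

text \<open>Symmetry of \<open>curv\<close> brings the traced index into the last slot of the
  curvature. There the divergence of curvature is -G^ql \<nabla>_k R^k_pjl, which contracted Bianchi
  and \<open>riem_time\<close> identify with R^q_pj\<tau>. The derivative falling on
  \<open>h\<close> gives the double trace.\<close>

lemma div_curv:
  assumes x: "x \<in> S"
  shows "gtrace (G x) (\<lambda>k l. cov2 S \<Gamma> (curv h) x k l j) = curv h x \<tau> j
    + gtrace (G x) (\<lambda>p q. gtrace (G x) (\<lambda>k l. \<Sum>m\<in>UNIV. riem S \<Gamma> x m p k j * cov2 S \<Gamma> h x l q m))"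
proof -
  let ?T = "cov2 S \<Gamma> h x"
  have "cov2 S \<Gamma> (curv h) x k l j = cov2 S \<Gamma> (\<lambda>y i j. curv h y j i) x k l j" for k l
    by (rule cov2_cong[OF x]) (simp add: curv_sym h_sym)
  also have "\<dots> k l = cov2 S \<Gamma> (curv h) x k j l" for k l
    by (simp add: cov2_def)
  finally have "cov2 S \<Gamma> (curv h) x k l j = gtrace (G x) (\<lambda>p r. \<Sum>q\<in>UNIV. ?T k r q * riem S \<Gamma> x q p j l)
      + gtrace (G x) (\<lambda>p r. \<Sum>q\<in>UNIV. h x r q * cov_riem S \<Gamma> x k q p j l)" for k l
    by (simp add: cov2_curv[OF x] sum.distrib gtrace_add)
  \<comment> \<open>At a fixed point \<nabla>_k h is itself a symmetric array, so
    \<open>curv_sym\<close> applies to it and restores the original order of \<open>j\<close> and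
    \<open>l\<close>.\<close>
  moreover have "gtrace (G x) (\<lambda>p r. \<Sum>q\<in>UNIV. ?T k r q * riem S \<Gamma> x q p j l)
      = gtrace (G x) (\<lambda>p r. \<Sum>q\<in>UNIV. riem S \<Gamma> x q p l j * ?T k r q)" for k l
    using curv_sym[OF x, of "\<lambda>_. ?T k" j l] cov2_sym[OF x] by (simp add: curv_def mult.commute)
  moreover have "gtrace (G x) (\<lambda>k l. gtrace (G x) (\<lambda>p r. \<Sum>q\<in>UNIV. riem S \<Gamma> x q p l j * ?T k r q))
      = gtrace (G x) (\<lambda>p r. gtrace (G x) (\<lambda>k l. \<Sum>q\<in>UNIV. riem S \<Gamma> x q p k j * ?T l r q))"
    by (subst gtrace_swap, subst gtrace_transpose[symmetric]) (simp_all add: metric_sym[OF x])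
  moreover have "gtrace (G x) (\<lambda>k l. gtrace (G x) (\<lambda>p r. \<Sum>q\<in>UNIV. h x r q * cov_riem S \<Gamma> x k q p j l))
      = curv h x \<tau> j"
  proof -
    have "gtrace (G x) (\<lambda>k l. cov_riem S \<Gamma> x k q p j l) = riem S \<Gamma> x q p j \<tau>" for p q
    proof -
      have "gtrace (G x) (\<lambda>k l. cov_riem S \<Gamma> x k q p j l) = - (\<Sum>k\<in>UNIV. \<Sum>l\<in>UNIV. G x q l * cov_riem S \<Gamma> x k k p j l)"
        by (simp add: gtrace_def cov_riem_raised_antisym[OF x, of _ _ q] sum_negf)
      also have "(\<Sum>k\<in>UNIV. \<Sum>l\<in>UNIV. G x q l * cov_riem S \<Gamma> x k k p j l)
          = (\<Sum>l\<in>UNIV. G x q l * (\<Sum>k\<in>UNIV. cov_riem S \<Gamma> x k k p j l))"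
        by (subst sum.swap) (simp add: sum_distrib_left)
      finally show ?thesis
        by (simp add: contracted_bianchi2[OF x] riem_time[OF x] sum_linear)
    qed
    then have "gtrace (G x) (\<lambda>k l. gtrace (G x) (\<lambda>p r. \<Sum>q\<in>UNIV. h x r q * cov_riem S \<Gamma> x k q p j l)) = curv h x j \<tau>"
      by (subst gtrace_swap) (simp add: gtrace_sum gtrace_cmult curv_def)
    then show ?thesis
      using curv_sym[OF x, of h \<tau> j] h_sym[OF x] by simp
  qed
  ultimately show ?thesis
    by (simp add: gtrace_add)
qed

text \<open>The divergence index is commuted past the outer derivative of the Laplacian, and
  \<open>trace_cov3_cov2\<close> then evaluates the inner trace. Two of the three curvature terms
  contract to Ricci and become Christoffel terms in the time direction. One of these cancels the
  correction left by the inner trace, the other stays; the full curvature term is the one found in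
  \<open>div_curv\<close>.\<close>

lemma div_laplace2:
  assumes x: "x \<in> S"
  shows "gtrace (G x) (\<lambda>p q. cov2 S \<Gamma> (laplace2 S G \<Gamma> h) x p q j) = laplace2 S G \<Gamma> h x \<tau> j
    - gtrace (G x) (\<lambda>k l. cov2 S \<Gamma> (curv h) x k l j)
    + gtrace (G x) (\<lambda>p q. \<Sum>m\<in>UNIV. \<Gamma> x p \<tau> m * cov2 S \<Gamma> h x m q j)
    - gtrace (G x) (\<lambda>p q. gtrace (G x) (\<lambda>k l. \<Sum>m\<in>UNIV. riem S \<Gamma> x m p k j * cov2 S \<Gamma> h x l q m))"
proof -
  let ?T = "cov2 S \<Gamma> h"
  let ?g = "gtrace (G x)"
  have "cov2 S \<Gamma> (laplace2 S G \<Gamma> h) x p q j = ?g (\<lambda>k l. cov4 S \<Gamma> (cov3 S \<Gamma> ?T) x p k l q j)" for p q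
    using cov2_gtrace[OF x, of "cov3 S \<Gamma> ?T" p q j]
    by (simp add: gtrace_def laplace2_def[abs_def])
  also have "\<dots> p q = ?g (\<lambda>k l. cov4 S \<Gamma> (cov3 S \<Gamma> ?T) x k p l q j)
      - ?g (\<lambda>k l. \<Sum>m\<in>UNIV. riem S \<Gamma> x m p k l * ?T x m q j)
      - ?g (\<lambda>k l. \<Sum>m\<in>UNIV. riem S \<Gamma> x m p k q * ?T x l m j)
      - ?g (\<lambda>k l. \<Sum>m\<in>UNIV. riem S \<Gamma> x m p k j * ?T x l q m)" for p q
  proof -
    have "cov4 S \<Gamma> (cov3 S \<Gamma> ?T) x p k l q j = cov4 S \<Gamma> (cov3 S \<Gamma> ?T) x k p l q j
      - (\<Sum>m\<in>UNIV. riem S \<Gamma> x m p k l * ?T x m q j) - (\<Sum>m\<in>UNIV. riem S \<Gamma> x m p k q * ?T x l m j)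
      - (\<Sum>m\<in>UNIV. riem S \<Gamma> x m p k j * ?T x l q m)" for k l
      using ricci_identity3[OF x, of ?T p k l q j] by simp
    then show ?thesis by (simp add: gtrace_diff)
  qed
  finally have "?g (\<lambda>p q. cov2 S \<Gamma> (laplace2 S G \<Gamma> h) x p q j) =
      ?g (\<lambda>p q. ?g (\<lambda>k l. cov4 S \<Gamma> (cov3 S \<Gamma> ?T) x k p l q j))
      - ?g (\<lambda>p q. ?g (\<lambda>k l. \<Sum>m\<in>UNIV. riem S \<Gamma> x m p k l * ?T x m q j))
      - ?g (\<lambda>p q. ?g (\<lambda>k l. \<Sum>m\<in>UNIV. riem S \<Gamma> x m p k q * ?T x l m j))
      - ?g (\<lambda>p q. ?g (\<lambda>k l. \<Sum>m\<in>UNIV. riem S \<Gamma> x m p k j * ?T x l q m))"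
    by (simp add: gtrace_diff)
  moreover have "?g (\<lambda>p q. ?g (\<lambda>k l. cov4 S \<Gamma> (cov3 S \<Gamma> ?T) x k p l q j)) =
      laplace2 S G \<Gamma> h x \<tau> j + ?g (\<lambda>k l. \<Sum>m\<in>UNIV. \<Gamma> x k \<tau> m * ?T x l m j)
      - ?g (\<lambda>k l. cov2 S \<Gamma> (curv h) x k l j)"
  proof -
    have "?g (\<lambda>p q. cov4 S \<Gamma> (cov3 S \<Gamma> ?T) x k p l q j)
        = cov2 S \<Gamma> (\<lambda>y l j. gtrace (G y) (\<lambda>p q. cov3 S \<Gamma> ?T y p l q j)) x k l j" for k l
      by (rule cov2_gtrace13[OF x, symmetric]) simp
    also have "\<dots> k l = cov2 S \<Gamma> (\<lambda>y l j. ?T y l \<tau> j - curv h y l j) x k l j" for k l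
      by (rule cov2_cong[OF x]) (rule trace_cov3_cov2)
    also have "\<dots> k l = cov2 S \<Gamma> (\<lambda>y l j. ?T y l \<tau> j) x k l j - cov2 S \<Gamma> (curv h) x k l j" for k l
      by (rule cov2_diff[OF x]) simp_all
    also have "\<dots> k l = cov3 S \<Gamma> ?T x k l \<tau> j + (\<Sum>m\<in>UNIV. \<Gamma> x k \<tau> m * ?T x l m j)
        - cov2 S \<Gamma> (curv h) x k l j" for k l
      by (simp add: cov3_def cov2_def[of S \<Gamma> "\<lambda>y l j. ?T y l \<tau> j"])
    finally show ?thesis
      by (subst gtrace_swap) (simp add: gtrace_diff gtrace_add, simp add: gtrace_def laplace2_def)
  qed
  moreover have "?g (\<lambda>p q. ?g (\<lambda>k l. \<Sum>m\<in>UNIV. riem S \<Gamma> x m p k l * ?T x m q j))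
      = - ?g (\<lambda>p q. \<Sum>m\<in>UNIV. \<Gamma> x p \<tau> m * ?T x m q j)"
  proof -
    \<comment> \<open>Antisymmetry in the first pair brings the trace into the form of
      \<open>riem_contracted\<close>, which accounts for the sign.\<close>
    have "?g (\<lambda>k l. riem S \<Gamma> x m p k l) = \<Gamma> x p \<tau> m * - 1" for m p
      by (subst riem_antisym) (simp add: gtrace_minus riem_contracted[OF x] conn_time[OF x])
    then show ?thesis
      by (simp add: gtrace_sum gtrace_cmult_right sum_negf gtrace_minus)
  qed
  moreover have "?g (\<lambda>p q. ?g (\<lambda>k l. \<Sum>m\<in>UNIV. riem S \<Gamma> x m p k q * ?T x l m j))
      = ?g (\<lambda>k l. \<Sum>m\<in>UNIV. \<Gamma> x k \<tau> m * ?T x l m j)"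
    by (subst gtrace_swap)
      (simp add: gtrace_sum gtrace_cmult_right riem_contracted[OF x] conn_time[OF x])
  ultimately show ?thesis by simp
qed

text \<open>The Christoffel terms from \<nabla>_\<tau> h and from the Laplacian cancel. Of the
  divergence of \<open>curv\<close>, -2 comes from \<open>K\<close> and +1 from the Laplacian; by
  \<open>div_curv\<close> the remaining -1 cancels the double curvature trace and leaves one
  \<open>curv h x \<tau> j\<close>. A second one comes from commuting \<nabla>_\<tau>, which
  restores the coefficient 2.\<close>

proposition defect_time:
  assumes x: "x \<in> S"
    and K: "\<And>y i j. K y i j = cov2 S \<Gamma> h y \<tau> i j - laplace2 S G \<Gamma> h y i j - 2 * curv h y i j"
  shows "K x \<tau> j = gtrace (G x) (\<lambda>p q. cov2 S \<Gamma> K x p q j)"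
proof -
  let ?T = "cov2 S \<Gamma> h"
  let ?g = "gtrace (G x)"
  have L [simp]: "smooth_on S (\<lambda>y. laplace2 S G \<Gamma> h y i j)" for i j
    by (simp add: laplace2_def)
  have K': "K = (\<lambda>y i j. (\<lambda>y i j. ?T y \<tau> i j - laplace2 S G \<Gamma> h y i j) y i j - (\<lambda>y i j. 2 * curv h y i j) y i j)"
    by (simp add: fun_eq_iff K)
  have "cov2 S \<Gamma> K x p q j = cov2 S \<Gamma> (\<lambda>y. ?T y \<tau>) x p q j - cov2 S \<Gamma> (laplace2 S G \<Gamma> h) x p q j
      - 2 * cov2 S \<Gamma> (curv h) x p q j" for p q
    unfolding K' by (subst cov2_diff[OF x], simp, simp) (simp add: cov2_diff cov2_cmult x)
  moreover have "cov2 S \<Gamma> (\<lambda>y. ?T y \<tau>) x p q j = cov3 S \<Gamma> ?T x p \<tau> q j + (\<Sum>m\<in>UNIV. \<Gamma> x p \<tau> m * ?T x m q j)" for p q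
    by (simp add: cov3_def cov2_def[of S \<Gamma> "\<lambda>y. ?T y \<tau>"])
  ultimately have "?g (\<lambda>p q. cov2 S \<Gamma> K x p q j) = ?T x \<tau> \<tau> j - curv h x \<tau> j
      + ?g (\<lambda>p q. \<Sum>m\<in>UNIV. \<Gamma> x p \<tau> m * ?T x m q j)
      - ?g (\<lambda>p q. cov2 S \<Gamma> (laplace2 S G \<Gamma> h) x p q j) - 2 * ?g (\<lambda>p q. cov2 S \<Gamma> (curv h) x p q j)"
    by (simp add: gtrace_diff gtrace_add gtrace_cmult trace_cov3_cov2[OF x])
  then show ?thesis
    by (simp add: div_laplace2[OF x] div_curv[OF x] K)
qed

theorem evolution_time_components:
  assumes conn0: "\<And>y a b. y \<in> S \<Longrightarrow> \<Gamma> y a b \<tau> = 0" and G0: "\<And>y k. y \<in> S \<Longrightarrow> G y \<tau> k = 0"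
    and space: "\<And>y i j. y \<in> S \<Longrightarrow> i \<noteq> \<tau> \<Longrightarrow> j \<noteq> \<tau> \<Longrightarrow>
      cov2 S \<Gamma> h y \<tau> i j = laplace2 S G \<Gamma> h y i j + 2 * curv h y i j"
    and x: "x \<in> S"
  shows "cov2 S \<Gamma> h x \<tau> i j = laplace2 S G \<Gamma> h x i j + 2 * curv h x i j"
proof -
  define K where "K y i j = cov2 S \<Gamma> h y \<tau> i j - laplace2 S G \<Gamma> h y i j - 2 * curv h y i j" for y i j
  have K_sym: "K y i j = K y j i" if "y \<in> S" for y i j
    using that cov2_sym laplace2_sym curv_sym[OF that, of h] h_sym by (simp add: K_def)
  have K_time: "K y \<tau> j = gtrace (G y) (\<lambda>p q. cov2 S \<Gamma> K y p q j)" if "y \<in> S" for y j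
    by (rule defect_time[OF that]) (rule K_def)
  \<comment> \<open>Applied twice. For a space index \<open>j\<close> the vanishing in
    \<open>K0\<close> is the given equation; for \<open>j = \<tau>\<close> it is the mixed case just
    obtained, used with symmetry. \<open>K0\<close> is required at all points because
    \<open>K\<close> is differentiated.\<close>
  have step: "K y \<tau> j = 0"
    if y: "y \<in> S" and K0: "\<And>y i. y \<in> S \<Longrightarrow> i \<noteq> \<tau> \<Longrightarrow> K y i j = 0"
      and Kj: "\<And>i q. q \<noteq> \<tau> \<Longrightarrow> i \<noteq> \<tau> \<Longrightarrow> K y q i = 0" for y j
  proof -
    have "G y p q * cov2 S \<Gamma> K y p q j = 0" for p q
    proof (cases "p = \<tau> \<or> q = \<tau>")
      case True
      then show ?thesis using G0[OF y] metric_sym[OF y, of p q] by auto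
    next
      case False
      have "pd S p (\<lambda>y. K y q j) y = pd S p (\<lambda>y. 0) y"
        using K0 False by (intro pd_cong[OF y]) auto
      moreover have "\<Gamma> y p u r * K y r j = 0" "\<Gamma> y p u r * K y q r = 0" for u r
        using K0[OF y] Kj False conn0[OF y] by (cases "r = \<tau>"; simp)+
      then have "(\<Sum>r\<in>UNIV. \<Gamma> y p u r * K y r j) = 0" "(\<Sum>r\<in>UNIV. \<Gamma> y p u r * K y q r) = 0" for u
        by (intro sum.neutral; blast)+
      ultimately show ?thesis by (simp add: cov2_def pd_const y)
    qed
    then show ?thesis unfolding K_time[OF y] gtrace_def by (intro sum.neutral ballI)
  qed
  have K_space: "K y i j = 0" if "y \<in> S" "i \<noteq> \<tau>" "j \<noteq> \<tau>" for y i j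
    using space[OF that] by (simp add: K_def)
  have K_mixed: "K y \<tau> j = 0" if "y \<in> S" "j \<noteq> \<tau>" for y j
    using step[OF that(1), of j] K_space that by simp
  have "K x \<tau> \<tau> = 0"
    using step[OF x, of \<tau>] K_space[OF x] K_mixed K_sym by simp
  then have "K x i j = 0"
    using K_space[OF x, of i j] K_mixed[OF x] K_sym[OF x, of i \<tau>] by (cases "i = \<tau>"; cases "j = \<tau>") auto
  then show ?thesis by (simp add: K_def)
qed

end

end

section \<open>Smoothness of the inverse matrix\<close>

lemma (in pd_domain) smooth_on_det:
  assumes "\<And>i j. smooth_on S (\<lambda>x. A x $ i $ j)"
  shows "smooth_on S (\<lambda>x. det (A x :: real^'n^'n))"
  unfolding det_def
  by (intro smooth_on_sum smooth_on_mult smooth_on_const smooth_on_prod assms)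

lemma matrix_inv_right:
  fixes A :: "real^'n^'n"
  assumes "det A \<noteq> 0"
  shows "A ** matrix_inv A = mat 1"
proof -
  have "\<exists>B. A ** B = mat 1 \<and> B ** A = mat 1"
    using assms by (simp add: invertible_det_nz[symmetric] invertible_def)
  then show ?thesis unfolding matrix_inv_def by (rule someI2_ex) simp
qed

text \<open>Cramer's rule for the column \<open>j\<close> of the inverse. It exhibits the entries as
  rational functions of those of \<open>A\<close>, from which smoothness follows.\<close>

lemma matrix_inv_cofactor:
  fixes A :: "real^'n^'n"
  assumes "det A \<noteq> 0"
  shows "matrix_inv A $ i $ j = det (\<chi> a b. if b = i then axis j 1 $ a else A $ a $ b) * inverse (det A)"
proof -
  have "A ** matrix_inv A = mat 1"
    by (rule matrix_inv_right[OF assms])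
  then have "A *v (matrix_inv A *v axis j 1) = axis j 1"
    by (simp add: matrix_vector_mul_assoc)
  then have "matrix_inv A *v axis j 1 = (\<chi> k. det (\<chi> a b. if b = k then axis j 1 $ a else A $ a $ b) / det A)"
    using cramer[OF assms] by blast
  then have "(matrix_inv A *v axis j 1) $ i = det (\<chi> a b. if b = i then axis j 1 $ a else A $ a $ b) / det A"
    by simp
  then show ?thesis
    by (simp add: matrix_vector_mul_component inner_axis divide_inverse)
qed

lemma (in pd_domain) smooth_on_matrix_inv:
  assumes "\<And>i j. smooth_on S (\<lambda>x. A x $ i $ j)" "\<And>x. x \<in> S \<Longrightarrow> det (A x :: real^'n^'n) \<noteq> 0"
  shows "smooth_on S (\<lambda>x. matrix_inv (A x) $ i $ j)"
proof -
  have "smooth_on S (\<lambda>x. det (\<chi> a b. if b = i then axis j 1 $ a else A x $ a $ b) * inverse (det (A x)))"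
  proof (intro smooth_on_mult smooth_on_det smooth_on_inverse assms)
    show "smooth_on S (\<lambda>x. (\<chi> a b. if b = i then axis j 1 $ a else A x $ a $ b) $ a $ b)" for a b
      using assms(1) by (cases "b = i") simp_all
  qed
  moreover have "smooth_on S (\<lambda>x. matrix_inv (A x) $ i $ j) \<longleftrightarrow>
      smooth_on S (\<lambda>x. det (\<chi> a b. if b = i then axis j 1 $ a else A x $ a $ b) * inverse (det (A x)))"
    by (rule smooth_on_cong) (rule matrix_inv_cofactor[OF assms(2)])
  ultimately show ?thesis by simp
qed


section \<open>Space-time domains\<close>

lemma sum_option_UNIV: "(\<Sum>a\<in>UNIV. f a) = f None + (\<Sum>a\<in>UNIV. f (Some a))"
  for f :: "'n::finite option \<Rightarrow> real"
  by (simp add: UNIV_option_conv sum.reindex)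

lemma event_nth [simp]: "event t x $ None = t" "event t x $ Some i = x $ i"
  and space_part_event [simp]: "space_part (event t x) = x"
  by (simp_all add: event_def space_part_def vec_eq_iff)

lemma event_mem_st_dom [simp]: "event t x \<in> st_dom I \<Omega> \<longleftrightarrow> t \<in> I \<and> x \<in> \<Omega>"
  by (simp add: st_dom_def)

lemma shift_None:
  "(z + s *\<^sub>R axis None 1) $ None = z $ None + s"
  "space_part (z + s *\<^sub>R axis None 1) = space_part z"
  by (simp_all add: space_part_def axis_def vec_eq_iff)

lemma shift_Some:
  "(z + s *\<^sub>R axis (Some i) 1) $ None = z $ None" "axis (Some i) 1 $ None = (0::real)"
  "space_part (z + s *\<^sub>R axis (Some i) 1) = space_part z + s *\<^sub>R axis i 1"
  by (simp_all add: space_part_def axis_def vec_eq_iff)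

lemma line_in_st_dom:
  assumes "z \<in> st_dom I \<Omega>"
  shows "line_in (st_dom I \<Omega>) None z = {s. z $ None + s \<in> I}"
    and "line_in (st_dom I \<Omega>) (Some i) z = line_in \<Omega> i (space_part z)"
  using assms by (auto simp: line_in_def st_dom_def shift_None shift_Some)

text \<open>A coordinate line in a space direction stays in its time slice. This carries spatial
  geometry at a frozen time over to functions on space-time, where smoothness is stated.\<close>

lemma pd_space:
  assumes "z \<in> st_dom I \<Omega>"
  shows "pd \<Omega> i (f (z $ None)) (space_part z) =
    pd (st_dom I \<Omega>) (Some i) (\<lambda>w. f (w $ None) (space_part w)) z"
  by (simp add: pd_def line_in_st_dom[OF assms] shift_Some)

locale spacetime =
  fixes \<Omega> :: "(real^'n::finite) set" and T :: ereal
  assumes open_space: "open \<Omega>" and T_pos: "0 < T"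
begin

abbreviation I :: "real set" where "I \<equiv> time_interval T"

abbreviation S :: "(real^'n option) set" where "S \<equiv> st_dom I \<Omega>"

lemma time_room:
  assumes "t \<in> I"
  obtains e where "e > 0" "{t..<t + e} \<subseteq> I"
proof -
  have "ereal t < T" "0 \<le> t" using assms by (auto simp: time_interval_def)
  then obtain u where u: "t < u" "ereal u < T"
    using ereal_dense2[of "ereal t" T] by auto
  have "{t..<t + (u - t)} \<subseteq> I"
  proof
    fix s assume "s \<in> {t..<t + (u - t)}"
    then have "t \<le> s" "s < u" by auto
    then have "ereal s < T" using u(2) by (meson less_ereal.simps(1) less_trans)
    then show "s \<in> I" using \<open>0 \<le> t\<close> \<open>t \<le> s\<close> by (simp add: time_interval_def)
  qed
  then show thesis using u(1) that[of "u - t"] by simp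
qed

sublocale pd_domain S
proof
  fix z :: "real^'n option" and a assume z: "z \<in> S"
  then have t: "z $ None \<in> I" and x: "space_part z \<in> \<Omega>" by (auto simp: st_dom_def)
  show "at 0 within line_in S a z \<noteq> bot"
  proof (cases a)
    case None
    obtain e where e: "e > 0" "{z $ None..<z $ None + e} \<subseteq> I" using time_room[OF t] .
    then have "{0..e / 2} \<subseteq> line_in S a z"
      using None by (auto simp: line_in_st_dom[OF z])
    then have "at 0 within {0..e / 2} \<le> at 0 within line_in S a z" by (rule at_le)
    moreover have "at (0::real) within {0..e / 2} \<noteq> bot"
      using e(1) by (simp add: at_within_Icc_at_right)
    ultimately show ?thesis by (metis bot.extremum_uniqueI)
  next
    case (Some i)
    have "open ((\<lambda>s. space_part z + s *\<^sub>R axis i 1) -` \<Omega>)"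
      by (intro open_vimage open_space continuous_intros)
    then have "open (line_in \<Omega> i (space_part z))"
      by (simp add: line_in_def vimage_def)
    then have "at 0 within line_in \<Omega> i (space_part z) = at 0"
      by (intro at_within_open zero_in_line_in x)
    then show ?thesis
      unfolding Some line_in_st_dom(2)[OF z] by simp
  qed
next
  have op: "open {z :: real^'n option. 0 < z $ None \<and> ereal (z $ None) < T \<and> space_part z \<in> \<Omega>}" (is "open ?U")
  proof -
    have "open ((\<lambda>z :: real^'n option. z $ None) -` {t. 0 < t \<and> ereal t < T})"
    proof (rule open_vimage)
      have "{t. 0 < t \<and> ereal t < T} = {0<..} \<inter> ereal -` {..<T}" by auto
      then show "open {t. 0 < t \<and> ereal t < T}"
        by (auto intro!: open_Int open_vimage continuous_intros)
    qed (intro continuous_intros)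
    moreover have "open (space_part -` \<Omega> :: (real^'n option) set)"
      unfolding space_part_def by (intro open_vimage open_space continuous_intros)
    moreover have "?U = ((\<lambda>z. z $ None) -` {t. 0 < t \<and> ereal t < T}) \<inter> (space_part -` \<Omega>)"
      by auto
    ultimately show ?thesis by (auto intro: open_Int)
  qed
  have U: "?U \<subseteq> interior S"
    by (rule interior_maximal[OF _ op]) (auto simp: st_dom_def time_interval_def)
  show "S \<subseteq> closure (interior S)"
  proof
    fix z assume z: "z \<in> S"
    then have t: "z $ None \<in> I" and x: "space_part z \<in> \<Omega>" by (auto simp: st_dom_def)
    obtain e where e: "e > 0" "{z $ None..<z $ None + e} \<subseteq> I" using time_room[OF t] .
    \<comment> \<open>Forward shifts in time avoid the slice t = 0. The denominator
      \<open>n + 2\<close> keeps the shift strictly below \<open>e\<close> from the start, hence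
      before \<open>T\<close>.\<close>
    define u where "u n = z + (e / real (n + 2)) *\<^sub>R axis None 1" for n
    have "u n \<in> interior S" for n
    proof -
      have "0 < e / real (n + 2)" "e / real (n + 2) < e"
        using e(1) by (auto simp: field_simps intro: add_pos_nonneg)
      moreover from this have "0 < z $ None + e / real (n + 2)"
        using t by (simp add: time_interval_def add_nonneg_pos)
      ultimately have "u n \<in> ?U"
        using e t x by (auto simp: u_def shift_None time_interval_def subset_iff)
      then show ?thesis using U by blast
    qed
    moreover have "u \<longlonglongrightarrow> z"
    proof -
      have "(\<lambda>n. e / real (n + 2)) \<longlonglongrightarrow> 0"
        by (rule LIMSEQ_ignore_initial_segment[OF lim_const_over_n])
      then have "u \<longlonglongrightarrow> z + 0 *\<^sub>R axis None 1"
        unfolding u_def by (intro tendsto_intros)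
      then show ?thesis by simp
    qed
    ultimately show "z \<in> closure (interior S)"
      unfolding closure_sequential by blast
  qed
qed

lemma shift_image_eq: "(+) t ` {s. t + s \<in> I} = I"
  by (auto simp: image_def intro!: exI[of _ "_ - t"])

lemma pd_time:
  assumes z: "z \<in> S"
    and d: "((\<lambda>s. f s (space_part z)) has_real_derivative d) (at (z $ None) within I)"
  shows "pd S None (\<lambda>w. f (w $ None) (space_part w)) z = d"
proof (rule pd_eqI(2)[OF z])
  have "((\<lambda>s. f (z $ None + s) (space_part z)) has_real_derivative d) (at 0 within {s. z $ None + s \<in> I})"
    using d by (subst DERIV_at_within_shift[symmetric]) (simp add: shift_image_eq)
  then show "((\<lambda>s. f ((z + s *\<^sub>R axis None 1) $ None) (space_part (z + s *\<^sub>R axis None 1))) has_vector_derivative d)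
      (at 0 within line_in S None z)"
    by (simp add: line_in_st_dom[OF z] shift_None has_real_derivative_iff_has_vector_derivative)
qed

lemma has_derivative_time:
  assumes t: "t \<in> I" and x: "x \<in> \<Omega>" and f: "smooth_on S f"
  shows "((\<lambda>s. f (event s x)) has_real_derivative pd S None f (event t x)) (at t within I)"
proof -
  let ?z = "event t x"
  have z: "?z \<in> S" using t x by simp
  have ev: "event t x + s *\<^sub>R axis None 1 = event (t + s) x" for s
    by (simp add: vec_eq_iff event_def axis_def split: option.split)
  have "((\<lambda>s. f (event (t + s) x)) has_real_derivative pd S None f ?z) (at 0 within {s. t + s \<in> I})"
    using smooth_on_has_pd[OF f z, of None]
    by (simp add: has_pd_iff line_in_st_dom[OF z] ev has_real_derivative_iff_has_vector_derivative)
  then show ?thesis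
    by (subst (asm) DERIV_at_within_shift[symmetric]) (simp add: shift_image_eq)
qed

end

section \<open>The space-time connection of a Ricci flow in a chart\<close>

lemma det_nonzero_if_posdef:
  fixes A :: "real^'n^'n"
  assumes "\<And>v. v \<noteq> 0 \<Longrightarrow> (\<Sum>i\<in>UNIV. \<Sum>j\<in>UNIV. A $ i $ j * v $ i * v $ j) > 0"
  shows "det A \<noteq> 0"
proof -
  have "v = 0" if "A *v v = 0" for v
  proof (rule ccontr)
    assume "v \<noteq> 0"
    have "(\<Sum>i\<in>UNIV. \<Sum>j\<in>UNIV. A $ i $ j * v $ i * v $ j) = (\<Sum>i\<in>UNIV. v $ i * (A *v v) $ i)"
      by (simp add: matrix_vector_mult_def sum_distrib_left ac_simps)
    also have "\<dots> = 0" by (simp add: that)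
    finally show False using assms[OF \<open>v \<noteq> 0\<close>] by simp
  qed
  then have "invertible A"
    by (simp add: invertible_left_inverse matrix_left_invertible_ker)
  then show ?thesis by (simp add: invertible_det_nz)
qed

lemma st_conn_None [simp]: "st_conn \<Omega> g z a b None = 0"
  by (cases a; cases b) auto

lemma st_cometric_None [simp]: "st_cometric g z a None = 0"
  by (cases a) auto

locale flow_chart = spacetime \<Omega> T for \<Omega> :: "(real^'n::finite) set" and T +
  fixes g :: "real \<Rightarrow> 'n form2"
  assumes g_smooth [simp]: "smooth_on S (\<lambda>z. g (z $ None) (space_part z) i j)"
    and g_sym: "t \<in> I \<Longrightarrow> x \<in> \<Omega> \<Longrightarrow> g t x i j = g t x j i"
    and g_pos: "t \<in> I \<Longrightarrow> x \<in> \<Omega> \<Longrightarrow> v \<noteq> 0 \<Longrightarrow>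
      (\<Sum>i\<in>UNIV. \<Sum>j\<in>UNIV. g t x i j * v $ i * v $ j) > 0"
    and flow: "t \<in> I \<Longrightarrow> x \<in> \<Omega> \<Longrightarrow>
      ((\<lambda>s. g s x i j) has_real_derivative - 2 * Rc \<Omega> (g t) x i j) (at t within I)"
begin

lemma st_domD:
  assumes "z \<in> S"
  shows "z $ None \<in> I" "space_part z \<in> \<Omega>"
  using assms by (auto simp: st_dom_def)

lemma det_g: "t \<in> I \<Longrightarrow> x \<in> \<Omega> \<Longrightarrow> det (\<chi> a b. g t x a b) \<noteq> 0"
  using g_pos by (intro det_nonzero_if_posdef) simp

lemma ginv_smooth [simp]: "smooth_on S (\<lambda>z. metric_inv (g (z $ None)) (space_part z) i j)"
  unfolding metric_inv_def
  by (rule smooth_on_matrix_inv) (simp_all add: det_g st_domD)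

lemma g_ginv:
  assumes "t \<in> I" "x \<in> \<Omega>"
  shows "(\<Sum>k\<in>UNIV. g t x i k * metric_inv (g t) x k j) = (if i = j then 1 else 0)"
  using matrix_inv_right[OF det_g[OF assms]]
  by (simp add: vec_eq_iff matrix_matrix_mult_def mat_def metric_inv_def)

lemma ginv_sym:
  assumes "t \<in> I" "x \<in> \<Omega>"
  shows "metric_inv (g t) x i j = metric_inv (g t) x j i"
proof -
  define A :: "real^'n^'n" where "A = (\<chi> a b. g t x a b)"
  have A: "A ** matrix_inv A = mat 1"
    unfolding A_def by (rule matrix_inv_right[OF det_g[OF assms]])
  have "transpose A = A"
    using g_sym[OF assms] by (simp add: A_def transpose_def vec_eq_iff)
  then have "transpose (matrix_inv A) ** A = mat 1"
    using arg_cong[OF A, of transpose] by (simp add: matrix_transpose_mul transpose_mat)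
  then have "transpose (matrix_inv A) = matrix_inv A"
    using A by (metis matrix_mul_assoc matrix_mul_lid matrix_mul_rid)
  then have "transpose (matrix_inv A) $ i $ j = matrix_inv A $ i $ j" by simp
  then show ?thesis by (simp add: transpose_def metric_inv_def A_def)
qed

lemma ginv_g:
  assumes "t \<in> I" "x \<in> \<Omega>"
  shows "(\<Sum>k\<in>UNIV. metric_inv (g t) x i k * g t x k j) = (if i = j then 1 else 0)"
  using g_ginv[OF assms, of j i]
  by (simp add: g_sym[OF assms, of j] ginv_sym[OF assms, of _ i] mult.commute eq_commute)

text \<open>Differentiating the product of the inverse with \<open>g\<close>, which is constant, and
  multiplying by the inverse from the right.\<close>

lemma pd_ginv:
  assumes z: "z \<in> S"
  shows "pd S a (\<lambda>w. metric_inv (g (w $ None)) (space_part w) i j) z =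
    - (\<Sum>b\<in>UNIV. \<Sum>c\<in>UNIV. metric_inv (g (z $ None)) (space_part z) i b *
        pd S a (\<lambda>w. g (w $ None) (space_part w) b c) z * metric_inv (g (z $ None)) (space_part z) c j)"
proof -
  let ?M = "\<lambda>w. metric_inv (g (w $ None)) (space_part w)"
  let ?g = "\<lambda>w. g (w $ None) (space_part w)"
  note zz = st_domD[OF z]
  have "(\<Sum>b\<in>UNIV. pd S a (\<lambda>w. ?M w i b) z * ?g z b c + ?M z i b * pd S a (\<lambda>w. ?g w b c) z) = 0" for c
  proof -
    have "pd S a (\<lambda>w. \<Sum>b\<in>UNIV. ?M w i b * ?g w b c) z = pd S a (\<lambda>w. if i = c then 1 else 0) z"
      by (rule pd_cong[OF z]) (rule ginv_g[OF st_domD])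
    then show ?thesis by (simp add: pd_smooth z)
  qed
  then have "(\<Sum>c\<in>UNIV. (\<Sum>b\<in>UNIV. pd S a (\<lambda>w. ?M w i b) z * ?g z b c) * ?M z c j)
      = (\<Sum>c\<in>UNIV. - (\<Sum>b\<in>UNIV. ?M z i b * pd S a (\<lambda>w. ?g w b c) z) * ?M z c j)"
    by (intro sum.cong refl arg_cong2[where f="(*)"]) (simp add: sum.distrib eq_neg_iff_add_eq_0)
  also have "(\<Sum>c\<in>UNIV. (\<Sum>b\<in>UNIV. pd S a (\<lambda>w. ?M w i b) z * ?g z b c) * ?M z c j)
      = pd S a (\<lambda>w. ?M w i j) z"
    by (simp add: sum_mult_assoc g_ginv[OF zz] if_distrib cong: if_cong)
  also have "(\<Sum>c\<in>UNIV. - (\<Sum>b\<in>UNIV. ?M z i b * pd S a (\<lambda>w. ?g w b c) z) * ?M z c j)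
      = - (\<Sum>b\<in>UNIV. \<Sum>c\<in>UNIV. ?M z i b * pd S a (\<lambda>w. ?g w b c) z * ?M z c j)"
    by (simp add: sum_distrib_right sum_negf) (rule sum.swap)
  finally show ?thesis .
qed

lemma levi_civita_eq:
  assumes z: "z \<in> S"
  shows "levi_civita \<Omega> (g (z $ None)) (space_part z) i j k =
    1/2 * (\<Sum>l\<in>UNIV. metric_inv (g (z $ None)) (space_part z) k l *
      (pd S (Some i) (\<lambda>w. g (w $ None) (space_part w) j l) z
       + pd S (Some j) (\<lambda>w. g (w $ None) (space_part w) i l) z
       - pd S (Some l) (\<lambda>w. g (w $ None) (space_part w) i j) z))"
  by (simp add: levi_civita_def pd_space[OF z, where f="\<lambda>t y. g t y _ _"])

lemma levi_civita_smooth [simp]: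
  "smooth_on S (\<lambda>z. levi_civita \<Omega> (g (z $ None)) (space_part z) i j k)"
  by (subst smooth_on_cong[OF levi_civita_eq]) (assumption, simp)

lemma levi_civita_sym:
  assumes z: "z \<in> S"
  shows "levi_civita \<Omega> (g (z $ None)) (space_part z) i j k = levi_civita \<Omega> (g (z $ None)) (space_part z) j i k"
proof -
  have "pd S (Some l) (\<lambda>w. g (w $ None) (space_part w) i j) z = pd S (Some l) (\<lambda>w. g (w $ None) (space_part w) j i) z" for l
    by (rule pd_cong[OF z]) (rule g_sym[OF st_domD])
  then show ?thesis by (simp add: levi_civita_eq[OF z] add.commute)
qed

lemma pd_g:
  assumes z: "z \<in> S"
  shows "pd S (Some k) (\<lambda>w. g (w $ None) (space_part w) b c) z =
    (\<Sum>l\<in>UNIV. levi_civita \<Omega> (g (z $ None)) (space_part z) k b l * g (z $ None) (space_part z) l c)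
    + (\<Sum>l\<in>UNIV. levi_civita \<Omega> (g (z $ None)) (space_part z) k c l * g (z $ None) (space_part z) l b)"
proof -
  let ?M = "metric_inv (g (z $ None)) (space_part z)"
  let ?g = "g (z $ None) (space_part z)"
  note zz = st_domD[OF z]
  have s: "pd S (Some l) (\<lambda>w. g (w $ None) (space_part w) i j) z = pd S (Some l) (\<lambda>w. g (w $ None) (space_part w) j i) z" for l i j
    by (rule pd_cong[OF z]) (rule g_sym[OF st_domD])
  have low: "(\<Sum>l\<in>UNIV. (1/2 * (\<Sum>m\<in>UNIV. ?M l m * X m)) * ?g l c) = 1/2 * X c" for X c
  proof -
    have "(\<Sum>l\<in>UNIV. (1/2 * (\<Sum>m\<in>UNIV. ?M l m * X m)) * ?g l c) = 1/2 * (\<Sum>m\<in>UNIV. X m * (\<Sum>l\<in>UNIV. ?M m l * ?g l c))"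
      by (simp add: sum_distrib_left sum_distrib_right ginv_sym[OF zz, of _ _] ac_simps, subst sum.swap)
        (simp add: ginv_sym[OF zz] ac_simps)
    then show ?thesis by (simp add: ginv_g[OF zz] if_distrib cong: if_cong)
  qed
  show ?thesis
    unfolding levi_civita_eq[OF z] low s[of k c b] by (simp add: add_divide_distrib diff_divide_distrib)
qed

text \<open>Coefficients with upper time index vanish, so in the quadratic terms the time value of
  the summed index contributes nothing.\<close>

lemma riem_space:
  assumes z: "z \<in> S"
  shows "riem \<Omega> (levi_civita \<Omega> (g (z $ None))) (space_part z) l i j k =
    riem S (st_conn \<Omega> g) z (Some l) (Some i) (Some j) (Some k)"
  by (simp add: riem_def sum_option_UNIV pd_space[OF z, where f="\<lambda>t y. levi_civita \<Omega> (g t) y _ _ _"])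

lemma riem_None: "z \<in> S \<Longrightarrow> riem S (st_conn \<Omega> g) z None i j k = 0"
  by (simp add: riem_def pd_const)

lemma Rc_eq:
  assumes z: "z \<in> S"
  shows "Rc \<Omega> (g (z $ None)) (space_part z) j k = ric S (st_conn \<Omega> g) z (Some j) (Some k)"
  by (simp add: Rc_def ric_def riem_space[OF z] sum_option_UNIV riem_None[OF z])

text \<open>Smoothness of \<open>st_conn\<close> is not yet available, as its time coefficients
  contain Ricci itself. The space components of curvature involve Levi-Civita coefficients only,
  which breaks the circle.\<close>

lemma Rc_smooth [simp]: "smooth_on S (\<lambda>z. Rc \<Omega> (g (z $ None)) (space_part z) j k)"
proof -
  have "smooth_on S (\<lambda>z. riem S (st_conn \<Omega> g) z (Some l) (Some i) (Some j) (Some k))" for l i j k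
    by (simp add: riem_def sum_option_UNIV)
  then have "smooth_on S (\<lambda>z. \<Sum>p\<in>UNIV. riem S (st_conn \<Omega> g) z (Some p) (Some p) (Some j) (Some k))"
    by simp
  then show ?thesis
    by (rule iffD2[OF smooth_on_cong, rotated])
      (simp add: Rc_eq ric_def sum_option_UNIV riem_None)
qed

text \<open>Read off from the flow: -2 Rc is the time derivative of the symmetric
  \<open>g\<close>.\<close>

lemma Rc_sym:
  assumes "t \<in> I" "x \<in> \<Omega>"
  shows "Rc \<Omega> (g t) x i j = Rc \<Omega> (g t) x j i"
proof -
  have z: "event t x \<in> S" using assms by simp
  have "pd S None (\<lambda>w. g (w $ None) (space_part w) i j) (event t x) = - 2 * Rc \<Omega> (g t) x i j" for i j
    using pd_time[OF z, of "\<lambda>s y. g s y i j"] flow[OF assms] by simp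
  moreover have "pd S None (\<lambda>w. g (w $ None) (space_part w) i j) (event t x)
      = pd S None (\<lambda>w. g (w $ None) (space_part w) j i) (event t x)"
    by (rule pd_cong[OF z]) (rule g_sym[OF st_domD])
  ultimately show ?thesis by simp
qed

lemma scal_eq:
  assumes z: "z \<in> S"
  shows "scal \<Omega> (g (z $ None)) (space_part z) = gtrace (st_cometric g z) (ric S (st_conn \<Omega> g) z)"
  by (simp add: scal_def gtrace_def sum_option_UNIV Rc_eq[OF z])

lemma scal_smooth [simp]: "smooth_on S (\<lambda>z. scal \<Omega> (g (z $ None)) (space_part z))"
  by (simp add: scal_def)

lemma Rc_up_smooth [simp]: "smooth_on S (\<lambda>z. Rc_up \<Omega> (g (z $ None)) (space_part z) i k)"
  by (simp add: Rc_up_def)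

lemma grad_scal_eq:
  assumes z: "z \<in> S"
  shows "grad_scal \<Omega> (g (z $ None)) (space_part z) k =
    (\<Sum>l\<in>UNIV. metric_inv (g (z $ None)) (space_part z) k l *
      pd S (Some l) (\<lambda>w. scal \<Omega> (g (w $ None)) (space_part w)) z)"
  by (simp add: grad_scal_def pd_space[OF z, where f="\<lambda>t. scal \<Omega> (g t)"])

lemma grad_scal_smooth [simp]: "smooth_on S (\<lambda>z. grad_scal \<Omega> (g (z $ None)) (space_part z) k)"
  by (subst smooth_on_cong[OF grad_scal_eq]) (assumption, simp)

sublocale connection_on S "st_conn \<Omega> g"
proof
  show "smooth_on S (\<lambda>y. st_conn \<Omega> g y i j k)" for i j k
    by (cases i; cases j; cases k) simp_all
  show "st_conn \<Omega> g z i j k = st_conn \<Omega> g z j i k" if "z \<in> S" for z i j k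
    using levi_civita_sym[OF that] by (cases i; cases j; cases k) simp_all
qed

text \<open>In space directions this is metric compatibility of the Levi-Civita connection. In the
  time direction Ricci flow gives the inverse metric the derivative 2R^ij, one half for each of the
  two corrections by \<Gamma>_0p^k = -R_p^k.\<close>

sublocale metric_connection S "st_conn \<Omega> g" "st_cometric g"
proof
  show "smooth_on S (\<lambda>y. st_cometric g y i j)" for i j
    by (cases i; cases j) simp_all
  show "st_cometric g z i j = st_cometric g z j i" if "z \<in> S" for z i j
    using ginv_sym[OF st_domD[OF that]] by (cases i; cases j) simp_all
  fix z a i j assume z: "z \<in> S"
  note zz = st_domD[OF z]
  let ?M = "metric_inv (g (z $ None)) (space_part z)"
  let ?g = "g (z $ None) (space_part z)"
  show "pd S a (\<lambda>y. st_cometric g y i j) z =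
      - (\<Sum>p\<in>UNIV. st_conn \<Omega> g z a p i * st_cometric g z p j)
      - (\<Sum>p\<in>UNIV. st_conn \<Omega> g z a p j * st_cometric g z i p)"
  proof (cases "i = None \<or> j = None")
    case True
    then show ?thesis by (auto simp: pd_const z)
  next
    case False
    then obtain i' j' where ij: "i = Some i'" "j = Some j'" by auto
    show ?thesis
    proof (cases a)
      case None
      have "pd S None (\<lambda>w. g (w $ None) (space_part w) b c) z = - 2 * Rc \<Omega> (g (z $ None)) (space_part z) b c" for b c
        using pd_time[OF z, of "\<lambda>s y. g s y b c"] flow[OF zz] by simp
      then have "pd S None (\<lambda>y. metric_inv (g (y $ None)) (space_part y) i' j') z =
          (\<Sum>b\<in>UNIV. \<Sum>c\<in>UNIV. ?M i' b * Rc \<Omega> (g (z $ None)) (space_part z) b c * ?M c j')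
          + (\<Sum>b\<in>UNIV. \<Sum>c\<in>UNIV. ?M i' b * Rc \<Omega> (g (z $ None)) (space_part z) b c * ?M c j')"
        by (simp add: pd_ginv[OF z] sum_negf sum_distrib_left[symmetric] mult.assoc mult.left_commute[of _ 2])
      moreover have "(\<Sum>b\<in>UNIV. \<Sum>c\<in>UNIV. ?M i' b * Rc \<Omega> (g (z $ None)) (space_part z) b c * ?M c j')
          = (\<Sum>p\<in>UNIV. Rc_up \<Omega> (g (z $ None)) (space_part z) p i' * ?M p j')"
        by (subst sum.swap) (simp add: Rc_up_def sum_distrib_right Rc_sym[OF zz])
      moreover have "(\<Sum>b\<in>UNIV. \<Sum>c\<in>UNIV. ?M i' b * Rc \<Omega> (g (z $ None)) (space_part z) b c * ?M c j')
          = (\<Sum>p\<in>UNIV. Rc_up \<Omega> (g (z $ None)) (space_part z) p j' * ?M i' p)"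
        by (simp add: Rc_up_def sum_distrib_left sum_distrib_right ginv_sym[OF zz, of j'] ac_simps)
      ultimately show ?thesis
        by (simp add: ij None sum_option_UNIV sum_negf)
    next
      case (Some k)
      let ?L = "levi_civita \<Omega> (g (z $ None)) (space_part z) k"
      have 1: "(\<Sum>b\<in>UNIV. \<Sum>c\<in>UNIV. ?M i' b * (\<Sum>l\<in>UNIV. ?L b l * ?g l c) * ?M c j')
          = (\<Sum>b\<in>UNIV. ?L b j' * ?M i' b)" for i' j'
      proof -
        have "(\<Sum>b\<in>UNIV. \<Sum>c\<in>UNIV. X b * Y b c * Z c) = (\<Sum>b\<in>UNIV. X b * (\<Sum>c\<in>UNIV. Y b c * Z c))"
          for X Z :: "'n \<Rightarrow> real" and Y
          by (simp add: sum_distrib_left mult.assoc)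
        then show ?thesis
          by (simp add: sum_mult_assoc g_ginv[OF zz] if_distrib cong: if_cong) (simp add: mult.commute)
      qed
      have 2: "(\<Sum>b\<in>UNIV. \<Sum>c\<in>UNIV. ?M i' b * (\<Sum>l\<in>UNIV. ?L c l * ?g l b) * ?M c j')
          = (\<Sum>b\<in>UNIV. ?L b i' * ?M b j')"
        using 1[of j' i'] by (subst sum.swap) (simp add: ginv_sym[OF zz, of j'] ginv_sym[OF zz, of i'] ac_simps)
      show ?thesis
        using 1[of i' j'] 2
        by (simp add: ij Some sum_option_UNIV pd_ginv[OF z] pd_g[OF z] distrib_left distrib_right sum.distrib)
    qed
  qed
qed

text \<open>With the curvature raised to an antisymmetric \<open>E\<close>, the trace pairs it with
  the symmetric \<open>g\<close>. Undoing the raising requires the nondegenerate space metric, so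
  the fact is established in the chart and handed to \<open>ric_time_index\<close> as a
  hypothesis.\<close>

lemma riem_trace_last:
  assumes z: "z \<in> S"
  shows "(\<Sum>p\<in>UNIV. riem S (st_conn \<Omega> g) z p i j p) = 0"
proof -
  note zz = st_domD[OF z]
  let ?M = "metric_inv (g (z $ None)) (space_part z)"
  let ?g = "g (z $ None) (space_part z)"
  define E where "E k l = (\<Sum>m\<in>UNIV. ?M k m * riem S (st_conn \<Omega> g) z (Some l) i j (Some m))" for k l
  have E: "E k l = - E l k" for k l
    using riem_raised_antisym[OF z, of "Some k" "Some l" i j]
    by (simp add: E_def sum_option_UNIV)
  have "riem S (st_conn \<Omega> g) z (Some l) i j (Some l) = (\<Sum>k\<in>UNIV. ?g l k * E k l)" for l
  proof -
    have "(\<Sum>k\<in>UNIV. ?g l k * E k l) = (\<Sum>m\<in>UNIV. (\<Sum>k\<in>UNIV. ?g l k * ?M k m) * riem S (st_conn \<Omega> g) z (Some l) i j (Some m))"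
      unfolding E_def by (rule sum_mult_assoc[symmetric])
    then show ?thesis by (simp add: g_ginv[OF zz] if_distrib[of "\<lambda>x. x * _"] cong: if_cong)
  qed
  then have tr: "(\<Sum>p\<in>UNIV. riem S (st_conn \<Omega> g) z p i j p) = (\<Sum>l\<in>UNIV. \<Sum>k\<in>UNIV. ?g l k * E k l)"
    by (simp add: sum_option_UNIV riem_None[OF z])
  also have "\<dots> = (\<Sum>k\<in>UNIV. \<Sum>l\<in>UNIV. - (?g k l * E l k))"
    by (subst sum.swap, intro sum.cong refl) (subst E, subst g_sym[OF zz], simp)
  also have "\<dots> = - (\<Sum>l\<in>UNIV. \<Sum>k\<in>UNIV. ?g l k * E k l)"
    by (simp add: sum_negf)
  finally show ?thesis using tr by simp
qed

lemma conn_time_space: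
  assumes z: "z \<in> S" and a: "a \<noteq> None"
  shows "st_conn \<Omega> g z a None k = - (\<Sum>l\<in>UNIV. st_cometric g z k l * ric S (st_conn \<Omega> g) z a l)"
  using a by (cases a; cases k) (simp_all add: sum_option_UNIV Rc_up_def Rc_eq[OF z])

text \<open>With this value, the prescribed coefficient -1/2 \<nabla>^k R of \<Gamma>_00^k is -G^kl
  R_0l, that is, the soliton relation in the time direction.\<close>

lemma ric_None_Some:
  assumes z: "z \<in> S"
  shows "ric S (st_conn \<Omega> g) z None (Some l) =
    1 / 2 * pd S (Some l) (\<lambda>w. scal \<Omega> (g (w $ None)) (space_part w)) z"
proof -
  have "ric S (st_conn \<Omega> g) z None (Some l) =
      1 / 2 * pd S (Some l) (\<lambda>y. gtrace (st_cometric g y) (ric S (st_conn \<Omega> g) y)) z"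
    using z by (intro ric_time_index conn_time_space) (simp_all add: riem_None riem_trace_last)
  also have "pd S (Some l) (\<lambda>y. gtrace (st_cometric g y) (ric S (st_conn \<Omega> g) y)) z
      = pd S (Some l) (\<lambda>w. scal \<Omega> (g (w $ None)) (space_part w)) z"
    by (rule pd_cong[OF z]) (simp add: scal_eq)
  finally show ?thesis .
qed

sublocale steady_connection S "st_conn \<Omega> g" "st_cometric g" None
proof
  fix z a k assume z: "z \<in> S"
  show "st_conn \<Omega> g z a None k = - (\<Sum>l\<in>UNIV. st_cometric g z k l * ric S (st_conn \<Omega> g) z a l)"
  proof (cases "a = None")
    case True
    then show ?thesis
      by (cases k) (simp_all add: sum_option_UNIV grad_scal_eq[OF z] ric_None_Some[OF z] sum_distrib_left sum_negf)
  qed (rule conn_time_space[OF z])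
qed

end

section \<open>The space-time extension of a solution\<close>

text \<open>The Christoffel corrections in \<nabla>_\<tau> h are the Ricci terms; this is the
  equivalence of the two forms of the evolution equation.\<close>

lemma (in steady_connection) ric_term_eq:
  assumes x: "x \<in> S" and h: "\<And>i j. h x i j = h x j i"
  shows "(\<Sum>p\<in>UNIV. \<Gamma> x \<tau> i p * h x p j) = - ric_term S G \<Gamma> h x i j"
proof -
  have "(\<Sum>p\<in>UNIV. \<Gamma> x \<tau> i p * h x p j) = - (\<Sum>p\<in>UNIV. \<Sum>l\<in>UNIV. G x l p * ric S \<Gamma> x i l * h x j p)"
    by (simp add: conn_sym[OF x, of \<tau>] conn_time[OF x] sum_negf sum_distrib_right
        metric_sym[OF x, of _ p for p] h[of _ j])
  then show ?thesis
    by (subst (asm) sum.swap) (simp add: ric_term_def)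
qed

section \<open>Components of the extension and their evolution in a chart\<close>

context flow_chart
begin

context
  fixes h :: "real \<Rightarrow> 'n form2"
  assumes h_smooth [simp]: "smooth_on S (\<lambda>z. h (z $ None) (space_part z) i j)"
    and h_sym: "t \<in> I \<Longrightarrow> x \<in> \<Omega> \<Longrightarrow> h t x i j = h t x j i"
    and h_evol: "t \<in> I \<Longrightarrow> x \<in> \<Omega> \<Longrightarrow>
      ((\<lambda>s. h s x i j) has_real_derivative evol_rhs \<Omega> (g t) (h t) x i j) (at t within I)"
begin

lemma cov2_space:
  assumes z: "z \<in> S"
  shows "cov2 \<Omega> (levi_civita \<Omega> (g (z $ None))) (h (z $ None)) (space_part z) k i j =
    cov2 S (st_conn \<Omega> g) (st_ext \<Omega> g h) z (Some k) (Some i) (Some j)"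
  by (simp add: cov2_def sum_option_UNIV pd_space[OF z, where f="\<lambda>t y. h t y _ _"])

lemma cov2_space_smooth [simp]:
  "smooth_on S (\<lambda>z. cov2 \<Omega> (levi_civita \<Omega> (g (z $ None))) (h (z $ None)) (space_part z) k i j)"
  by (subst smooth_on_cong[OF cov2_space], assumption) (simp add: cov2_def sum_option_UNIV)

lemma div2_smooth [simp]:
  "smooth_on S (\<lambda>z. div2 \<Omega> (g (z $ None)) (h (z $ None)) (space_part z) j)"
  by (simp add: div2_def)

lemma cov1_space:
  assumes z: "z \<in> S"
  shows "cov1 \<Omega> (levi_civita \<Omega> (g (z $ None))) (div2 \<Omega> (g (z $ None)) (h (z $ None))) (space_part z) j k =
    pd S (Some j) (\<lambda>w. div2 \<Omega> (g (w $ None)) (h (w $ None)) (space_part w) k) z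
    - (\<Sum>p\<in>UNIV. levi_civita \<Omega> (g (z $ None)) (space_part z) j k p *
        div2 \<Omega> (g (z $ None)) (h (z $ None)) (space_part z) p)"
  by (simp add: cov1_def pd_space[OF z, where f="\<lambda>t y. div2 \<Omega> (g t) (h t) y _"])

lemma cov1_space_smooth [simp]:
  "smooth_on S (\<lambda>z. cov1 \<Omega> (levi_civita \<Omega> (g (z $ None))) (div2 \<Omega> (g (z $ None)) (h (z $ None)))
    (space_part z) j k)"
  by (subst smooth_on_cong[OF cov1_space], assumption) simp

lemma st_ext_smooth [simp]: "smooth_on S (\<lambda>z. st_ext \<Omega> g h z i j)"
  by (cases i; cases j) (simp_all add: divdiv_def Rc_dot_def)

lemma st_ext_sym: "z \<in> S \<Longrightarrow> st_ext \<Omega> g h z i j = st_ext \<Omega> g h z j i"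
  using h_sym[OF st_domD] by (cases i; cases j) simp_all

text \<open>For \<open>j = None\<close> the derivative of the mixed component carries the correction
  -\<Gamma>_p0^r h_qr = R_p^r h_qr, whose trace is Rc \<cdot> h. This is the origin of that summand
  in the definition of the 00 component.\<close>

lemma st_ext_None:
  assumes z: "z \<in> S"
  shows "st_ext \<Omega> g h z None j =
    gtrace (st_cometric g z) (\<lambda>p q. cov2 S (st_conn \<Omega> g) (st_ext \<Omega> g h) z p q j)"
proof (cases j)
  case (Some j')
  then show ?thesis
    by (simp add: gtrace_def sum_option_UNIV div2_def cov2_space[OF z])
next
  case None
  note zz = st_domD[OF z]
  let ?M = "metric_inv (g (z $ None)) (space_part z)"
  let ?R = "Rc \<Omega> (g (z $ None)) (space_part z)"
  let ?h = "h (z $ None) (space_part z)"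
  have "cov2 S (st_conn \<Omega> g) (st_ext \<Omega> g h) z (Some p) (Some q) None =
      cov1 \<Omega> (levi_civita \<Omega> (g (z $ None))) (div2 \<Omega> (g (z $ None)) (h (z $ None))) (space_part z) p q
      + (\<Sum>r\<in>UNIV. Rc_up \<Omega> (g (z $ None)) (space_part z) p r * ?h q r)" for p q
    by (simp add: cov2_def sum_option_UNIV cov1_space[OF z] sum_negf)
  moreover have "Rc_dot \<Omega> (g (z $ None)) (h (z $ None)) (space_part z) =
      (\<Sum>p\<in>UNIV. \<Sum>q\<in>UNIV. ?M p q * (\<Sum>r\<in>UNIV. Rc_up \<Omega> (g (z $ None)) (space_part z) p r * ?h q r))"
  proof -
    have "Rc_dot \<Omega> (g (z $ None)) (h (z $ None)) (space_part z) =
        (\<Sum>p\<in>UNIV. \<Sum>q\<in>UNIV. \<Sum>l\<in>UNIV. \<Sum>r\<in>UNIV. ?M p q * ?M l r * ?R p l * ?h q r)"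
      unfolding Rc_dot_def by (rule sum.cong[OF refl], rule sum.swap)
    also have "\<dots> = (\<Sum>p\<in>UNIV. \<Sum>q\<in>UNIV. \<Sum>r\<in>UNIV. \<Sum>l\<in>UNIV. ?M p q * ?M r l * ?R p l * ?h q r)"
      by (rule sum.cong[OF refl], rule sum.cong[OF refl], subst sum.swap) (simp add: ginv_sym[OF zz])
    finally show ?thesis
      by (simp add: Rc_up_def sum_distrib_left sum_distrib_right ac_simps)
  qed
  ultimately show ?thesis
    using None by (simp add: gtrace_def sum_option_UNIV divdiv_def sum_linear)
qed

lemma laplace2_space:
  assumes z: "z \<in> S"
  shows "laplace2 \<Omega> (metric_inv (g (z $ None))) (levi_civita \<Omega> (g (z $ None))) (h (z $ None)) (space_part z) i j =
    laplace2 S (st_cometric g) (st_conn \<Omega> g) (st_ext \<Omega> g h) z (Some i) (Some j)"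
proof -
  let ?T = "cov2 S (st_conn \<Omega> g) (st_ext \<Omega> g h)"
  have "pd \<Omega> k (\<lambda>y. cov2 \<Omega> (levi_civita \<Omega> (g (z $ None))) (h (z $ None)) y l i j) (space_part z)
      = pd S (Some k) (\<lambda>w. ?T w (Some l) (Some i) (Some j)) z" for k l
    unfolding pd_space[OF z, where f="\<lambda>t y. cov2 \<Omega> (levi_civita \<Omega> (g t)) (h t) y l i j"]
    by (rule pd_cong[OF z]) (rule cov2_space)
  then show ?thesis
    by (simp add: laplace2_def sum_option_UNIV cov3_def cov2_space[OF z])
qed

lemma curv_space:
  assumes z: "z \<in> S"
  shows "curv (st_ext \<Omega> g h) z (Some i) (Some j) =
    (\<Sum>p\<in>UNIV. \<Sum>q\<in>UNIV. \<Sum>r\<in>UNIV. \<Sum>s\<in>UNIV.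
      metric_inv (g (z $ None)) (space_part z) p r * metric_inv (g (z $ None)) (space_part z) q s *
      Rm \<Omega> (g (z $ None)) (space_part z) p i j q * h (z $ None) (space_part z) r s)"
proof -
  note zz = st_domD[OF z]
  let ?M = "metric_inv (g (z $ None)) (space_part z)"
  let ?g = "g (z $ None) (space_part z)"
  let ?h = "h (z $ None) (space_part z)"
  let ?Rm = "Rm \<Omega> (g (z $ None)) (space_part z)"
  let ?R = "\<lambda>l i j k. riem S (st_conn \<Omega> g) z (Some l) (Some i) (Some j) (Some k)"
  \<comment> \<open>Raising the last index of \<open>Rm\<close> undoes the lowering in its
    definition, so the four-fold sum reduces to the single contraction with the cometric in
    \<open>curv\<close>.\<close>
  have up: "(\<Sum>q\<in>UNIV. ?M q s * ?Rm p i j q) = ?R s p i j" for p s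
  proof -
    have "(\<Sum>q\<in>UNIV. ?M q s * ?Rm p i j q) = (\<Sum>q\<in>UNIV. ?M s q * (\<Sum>m\<in>UNIV. ?g q m * ?R m p i j))"
      by (simp add: Rm_def riem_space[OF z] ginv_sym[OF zz, of _ s])
    also have "\<dots> = (\<Sum>m\<in>UNIV. (\<Sum>q\<in>UNIV. ?M s q * ?g q m) * ?R m p i j)"
      by (rule sum_mult_assoc[symmetric])
    finally show ?thesis by (simp add: ginv_g[OF zz] if_distrib[of "\<lambda>x. x * _"] cong: if_cong)
  qed
  have "(\<Sum>q\<in>UNIV. \<Sum>r\<in>UNIV. \<Sum>s\<in>UNIV. ?M p r * ?M q s * ?Rm p i j q * ?h r s)
      = (\<Sum>r\<in>UNIV. ?M p r * (\<Sum>s\<in>UNIV. ?h r s * ?R s p i j))" for p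
  proof -
    have "(\<Sum>q\<in>UNIV. \<Sum>r\<in>UNIV. \<Sum>s\<in>UNIV. ?M p r * ?M q s * ?Rm p i j q * ?h r s)
        = (\<Sum>r\<in>UNIV. \<Sum>s\<in>UNIV. \<Sum>q\<in>UNIV. ?M p r * ?M q s * ?Rm p i j q * ?h r s)"
      by (subst sum.swap, rule sum.cong[OF refl], rule sum.swap)
    also have "\<dots> = (\<Sum>r\<in>UNIV. ?M p r * (\<Sum>s\<in>UNIV. ?h r s * (\<Sum>q\<in>UNIV. ?M q s * ?Rm p i j q)))"
      by (simp add: sum_distrib_left ac_simps)
    finally show ?thesis by (simp only: up)
  qed
  then show ?thesis
    by (simp add: curv_def gtrace_def sum_option_UNIV riem_None[OF z])
qed

text \<open>The two Ricci terms of the given equation are the corrections by \<Gamma>_0i^p = -R_i^p,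
  so they are absorbed when the time derivative becomes covariant.\<close>

lemma evolution_space:
  assumes z: "z \<in> S"
  shows "cov2 S (st_conn \<Omega> g) (st_ext \<Omega> g h) z None (Some i) (Some j) =
    laplace2 S (st_cometric g) (st_conn \<Omega> g) (st_ext \<Omega> g h) z (Some i) (Some j)
    + 2 * curv (st_ext \<Omega> g h) z (Some i) (Some j)"
proof -
  note zz = st_domD[OF z]
  let ?M = "metric_inv (g (z $ None)) (space_part z)"
  let ?R = "Rc \<Omega> (g (z $ None)) (space_part z)"
  let ?h = "h (z $ None) (space_part z)"
  have d: "pd S None (\<lambda>w. h (w $ None) (space_part w) i j) z =
      evol_rhs \<Omega> (g (z $ None)) (h (z $ None)) (space_part z) i j"
    using pd_time[OF z, of "\<lambda>s y. h s y i j"] h_evol[OF zz] by simp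
  have r: "(\<Sum>p\<in>UNIV. Rc_up \<Omega> (g (z $ None)) (space_part z) a p * ?h b p) =
      (\<Sum>q\<in>UNIV. \<Sum>r\<in>UNIV. ?M q r * ?R a q * ?h b r)" for a b
    by (subst sum.swap) (simp add: Rc_up_def sum_distrib_right ginv_sym[OF zz])
  have "cov2 S (st_conn \<Omega> g) (st_ext \<Omega> g h) z None (Some i) (Some j) =
      evol_rhs \<Omega> (g (z $ None)) (h (z $ None)) (space_part z) i j
      + (\<Sum>p\<in>UNIV. Rc_up \<Omega> (g (z $ None)) (space_part z) i p * ?h j p)
      + (\<Sum>p\<in>UNIV. Rc_up \<Omega> (g (z $ None)) (space_part z) j p * ?h i p)"
    by (simp add: cov2_def sum_option_UNIV d sum_negf h_sym[OF zz, of _ j])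
  then show ?thesis
    by (simp add: evol_rhs_def r laplace2_space[OF z] curv_space[OF z])
qed

lemma evolution_spacetime:
  assumes z: "z \<in> S"
  shows "cov2 S (st_conn \<Omega> g) (st_ext \<Omega> g h) z None i j =
    laplace2 S (st_cometric g) (st_conn \<Omega> g) (st_ext \<Omega> g h) z i j
    + 2 * riem_term S (st_cometric g) (st_conn \<Omega> g) (st_ext \<Omega> g h) z i j"
  unfolding riem_term_eq_curv
proof (rule evolution_time_components[OF st_ext_smooth st_ext_sym st_ext_None _ _ _ z])
  fix y and i j :: "'n option" assume "y \<in> S" "i \<noteq> None" "j \<noteq> None"
  then show "cov2 S (st_conn \<Omega> g) (st_ext \<Omega> g h) y None i j =
      laplace2 S (st_cometric g) (st_conn \<Omega> g) (st_ext \<Omega> g h) y i j + 2 * curv (st_ext \<Omega> g h) y i j"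
    using evolution_space by (cases i; cases j) simp_all
qed simp_all

lemma evolution_spacetime_components:
  assumes t: "t \<in> I" and x: "x \<in> \<Omega>"
  shows "((\<lambda>s. st_ext \<Omega> g h (event s x) i j) has_real_derivative
    laplace2 S (st_cometric g) (st_conn \<Omega> g) (st_ext \<Omega> g h) (event t x) i j
    + 2 * riem_term S (st_cometric g) (st_conn \<Omega> g) (st_ext \<Omega> g h) (event t x) i j
    - ric_term S (st_cometric g) (st_conn \<Omega> g) (st_ext \<Omega> g h) (event t x) i j
    - ric_term S (st_cometric g) (st_conn \<Omega> g) (st_ext \<Omega> g h) (event t x) j i) (at t within I)"
proof -
  let ?z = "event t x" and ?H = "st_ext \<Omega> g h"
  have z: "?z \<in> S" using t x by simp
  have "(\<Sum>p\<in>UNIV. st_conn \<Omega> g ?z None j p * ?H ?z i p)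
      = (\<Sum>p\<in>UNIV. st_conn \<Omega> g ?z None j p * ?H ?z p i)"
    by (intro sum.cong refl) (simp add: st_ext_sym[OF z, of i])
  then have "pd S None (\<lambda>y. ?H y i j) ?z = cov2 S (st_conn \<Omega> g) ?H ?z None i j
      - ric_term S (st_cometric g) (st_conn \<Omega> g) ?H ?z i j
      - ric_term S (st_cometric g) (st_conn \<Omega> g) ?H ?z j i"
    using ric_term_eq[of ?z ?H i j, OF z st_ext_sym[OF z]] ric_term_eq[of ?z ?H j i, OF z st_ext_sym[OF z]]
    by (simp add: cov2_def)
  then show ?thesis
    using has_derivative_time[OF t x st_ext_smooth[of i j]] evolution_spacetime[OF z, of i j] by simp
qed

end

end

theorem proposition2p3:
  fixes M :: "'a topology"
    and A :: "('a, 'n::finite) chart set"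
    and T :: ereal
    and g h :: "real \<Rightarrow> ('a, 'n) tensor2"
  defines "I \<equiv> time_interval T"
  assumes "smooth_manifold M A"
    and "0 < T"
    and "ricci_flow A I g"
    and "time_dep_sym_tensor A I h"
    and "\<forall>t\<in>I. \<forall>c\<in>A. \<forall>x\<in>coord_dom c. \<forall>i j.
           ((\<lambda>s. h s c x i j) has_real_derivative evol_rhs (coord_dom c) (g t c) (h t c) x i j)
             (at t within I)"
  shows "\<forall>c\<in>A. \<forall>t\<in>I. \<forall>x\<in>coord_dom c. \<forall>i j :: 'n option.
           let \<Omega> = coord_dom c;
               S = st_dom I \<Omega>;
               z = event t x;
               G = st_cometric (\<lambda>s. g s c);
               \<Gamma> = st_conn \<Omega> (\<lambda>s. g s c);
               H = st_ext \<Omega> (\<lambda>s. g s c) (\<lambda>s. h s c)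
           in cov2 S \<Gamma> H z None i j =
                laplace2 S G \<Gamma> H z i j + 2 * riem_term S G \<Gamma> H z i j
            \<and> ((\<lambda>s. H (event s x) i j) has_real_derivative
                 laplace2 S G \<Gamma> H z i j + 2 * riem_term S G \<Gamma> H z i j
                 - ric_term S G \<Gamma> H z i j - ric_term S G \<Gamma> H z j i) (at t within I)"
proof (intro ballI allI)
  fix c t x and i j :: "'n option"
  assume c: "c \<in> A" and t: "t \<in> I" and x: "x \<in> coord_dom c"
  have g: "time_dep_metric A I g" and gs: "time_dep_sym_tensor A I g"
    using assms(4) by (simp_all add: ricci_flow_def time_dep_metric_def)
  \<comment> \<open>Hypotheses and conclusion are both expressed in components chart by chart, so
    the claim is settled on one coordinate domain at a time.\<close>
  interpret flow_chart "coord_dom c" T "\<lambda>s. g s c"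
  proof
    show "open (coord_dom c)"
      using assms(2) c by (simp add: smooth_manifold_def is_chart_def)
    show "0 < T" by fact
    show "smooth_on (st_dom (time_interval T) (coord_dom c)) (\<lambda>z. g (z $ None) c (space_part z) i j)" for i j
      using gs c by (simp add: time_dep_sym_tensor_def I_def)
    fix t x assume tx: "t \<in> time_interval T" "x \<in> coord_dom c"
    show "g t c x i j = g t c x j i" for i j
      using gs c tx by (simp add: time_dep_sym_tensor_def I_def)
    show "(\<Sum>i\<in>UNIV. \<Sum>j\<in>UNIV. g t c x i j * v $ i * v $ j) > 0" if "v \<noteq> 0" for v
      using g c tx that by (simp add: time_dep_metric_def I_def)
    show "((\<lambda>s. g s c x i j) has_real_derivative - 2 * Rc (coord_dom c) (g t c) x i j)
        (at t within time_interval T)" for i j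
      using assms(4) c tx by (simp add: ricci_flow_def I_def)
  qed
  have h: "smooth_on S (\<lambda>z. h (z $ None) c (space_part z) i j)"
    "\<And>t x. t \<in> time_interval T \<Longrightarrow> x \<in> coord_dom c \<Longrightarrow> h t c x i j = h t c x j i"
    "\<And>t x. t \<in> time_interval T \<Longrightarrow> x \<in> coord_dom c \<Longrightarrow>
      ((\<lambda>s. h s c x i j) has_real_derivative evol_rhs (coord_dom c) (g t c) (h t c) x i j) (at t within time_interval T)" for i j
    using assms(5,6) c by (simp_all add: time_dep_sym_tensor_def I_def)
  have t': "t \<in> time_interval T" using t by (simp add: I_def)
  then have z: "event t x \<in> S" using x by simp
  note evolution_spacetime[of "\<lambda>s. h s c", OF h z, of i j]
    and evolution_spacetime_components[of "\<lambda>s. h s c", OF h t' x, of i j]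
  then show "let \<Omega> = coord_dom c;
               S = st_dom I \<Omega>;
               z = event t x;
               G = st_cometric (\<lambda>s. g s c);
               \<Gamma> = st_conn \<Omega> (\<lambda>s. g s c);
               H = st_ext \<Omega> (\<lambda>s. g s c) (\<lambda>s. h s c)
           in cov2 S \<Gamma> H z None i j =
                laplace2 S G \<Gamma> H z i j + 2 * riem_term S G \<Gamma> H z i j
            \<and> ((\<lambda>s. H (event s x) i j) has_real_derivative
                 laplace2 S G \<Gamma> H z i j + 2 * riem_term S G \<Gamma> H z i j
                 - ric_term S G \<Gamma> H z i j - ric_term S G \<Gamma> H z j i) (at t within I)"
    unfolding Let_def I_def by (rule conjI)
qed

end
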